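(* Let $(X,\mathcal F)$ be a minimal foliated manifold (every leaf is dense) and let $\Lambda$ be a transverse invariant measure of $\mathcal F$ that is regular and without atoms. Then $\operatorname{Cat}(\mathcal F,\Lambda)=0$.
   Context: **Laminations.** A foliated chart of a Polish space $X$ is a pair $(U,\varphi)$ with $U\subset X$ open and $\varphi:U\to B^n\times S$ a homeomorphism, where $B^n$ is an open ball of $\mathbb R^n$ and $S$ is Polish; its plaques are the sets corresponding to $B^n\times\{s\}$, and $U\to S$ is its associated projection. A foliated atlas is a family of foliated charts $(U_i,\varphi_i)$ covering $X$ whose changes of coordinates are locally of the form $(x,s)\mapsto(f_{ij}(x,s),g_{ij}(s))$; a lamination $\mathcal F$ is a maximal foliated atlas. A foliated manifold is a manifold with a foliation, regarded as a lamination. The plaques form a base of the leaf topology, whose connected components are the leaves. A transversal is a subset $T\subset X$ such that the projection of every chart $U$ restricts to a local homeomorphism $U\cap T\to S$; it is complete if it meets every leaf. The holonomy pseudogroup is the pseudogroup generated by the maps $g_{ij}$ of a regular atlas on $\bigsqcup_iS_i$, or any equivalent one, such as its representative on a complete transversal. A transverse invariant measure $\Lambda$ is a measure on the space of a representative of the holonomy pseudogroup (e.g. on a complete transversal) invariant by its local transformations; it extends to all transverse sets (measurable sets meeting each leaf in a countable set), invariantly under measurable transformations keeping each point in its leaf. A measure is regular if the measure of each measurable set $B$ is the infimum of the measures of open sets containing $B$ and the supremum of the measures of compact sets contained in $B$. **$\Lambda$-category.** For $U\subset X$ open, $\mathcal F_U$ is the restriction of $\mathcal F$ to $U$, and $U\times\mathbb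 R$ is foliated by the products of leaves of $\mathcal F_U$ with $\mathbb R$. A tangential deformation of $U$ is a continuous foliated map (taking leaves into leaves) $H:U\times\mathbb R\to X$ with $H(-,0)$ the inclusion. It is a tangential contraction if $H(-,1)$ is constant on each leaf of $\mathcal F_U$; then $U$ is called tangentially categorical, and $H(U\times\{1\})$ is a transverse set (a countable union of local transversals). Put $\tau_\Lambda(U)=\inf_H\Lambda(H(U\times\{1\}))$ over tangential contractions $H$ of $U$, and $\operatorname{Cat}(\mathcal F,\Lambda)=\inf_{\mathcal V}\sum_{U\in\mathcal V}\tau_\Lambda(U)$ over coverings $\mathcal V$ of $X$ by tangentially categorical open sets. *)

theory Defs
  imports "HOL-Analysis.Analysis"
begin

section \<open>Laminations\<close>

text \<open>
  The transverse factor of a chart is a subset of the countable power of the real line. Every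
  Polish space is homeomorphic to such a subset, so this is no restriction. The leafwise factor
  lies in \<open>Euclidean_space n\<close>, the sequences vanishing from index \<open>n\<close> on, so that all dimensions
  \<open>n \<ge> 0\<close> are covered. The values of a coordinate map outside the domain \<open>fst c\<close> of a chart are
  irrelevant.
\<close>

type_synonym 'a chart = "'a set \<times> ('a \<Rightarrow> (nat \<Rightarrow> real) \<times> (nat \<Rightarrow> real))"

definition euclidean_ball :: "nat \<Rightarrow> (nat \<Rightarrow> real) \<Rightarrow> real \<Rightarrow> (nat \<Rightarrow> real) set" where
  "euclidean_ball n a r =
     {x \<in> topspace (Euclidean_space n). L2_set (\<lambda>i. x i - a i) {..<n} < r}"

definition polish_subset :: "'b::topological_space set \<Rightarrow> bool" where
  "polish_subset S \<longleftrightarrow>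
     completely_metrizable_space (top_of_set S) \<and> second_countable (top_of_set S)"

definition foliated_chart :: "nat \<Rightarrow> 'a::topological_space chart \<Rightarrow> bool" where
  "foliated_chart n c \<longleftrightarrow> open (fst c) \<and>
     (\<exists>a\<in>topspace (Euclidean_space n). \<exists>r>0. \<exists>S \<psi>. polish_subset S \<and>
        homeomorphism (fst c) (euclidean_ball n a r \<times> S) (snd c) \<psi>)"

definition chart_proj :: "'a chart \<Rightarrow> 'a \<Rightarrow> (nat \<Rightarrow> real)" where
  "chart_proj c y = snd (snd c y)"

definition chart_base :: "'a chart \<Rightarrow> (nat \<Rightarrow> real) set" where
  "chart_base c = chart_proj c ` fst c"

definition compatible_charts :: "'a::topological_space chart \<Rightarrow> 'a chart \<Rightarrow> bool" where
  "compatible_charts c d \<longleftrightarrow>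
     (\<forall>p\<in>fst c \<inter> fst d. \<exists>W. open W \<and> p \<in> W \<and> W \<subseteq> fst c \<inter> fst d \<and>
        (\<exists>f g. \<forall>y\<in>W. \<forall>x s. snd c y = (x, s) \<longrightarrow> snd d y = (f (x, s), g s)))"

definition foliated_atlas :: "nat \<Rightarrow> 'a::topological_space chart set \<Rightarrow> bool" where
  "foliated_atlas n A \<longleftrightarrow>
     (\<forall>c\<in>A. foliated_chart n c) \<and> (\<Union>c\<in>A. fst c) = UNIV \<and>
     (\<forall>c\<in>A. \<forall>d\<in>A. compatible_charts c d)"

definition lamination :: "nat \<Rightarrow> 'a::topological_space chart set \<Rightarrow> bool" where
  "lamination n F \<longleftrightarrow>
     foliated_atlas n F \<and> (\<forall>A. foliated_atlas n A \<and> F \<subseteq> A \<longrightarrow> A = F)"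

text \<open>
  A foliation of codimension \<open>q\<close> is given by foliated charts onto \<open>B \<times> S\<close> with \<open>S\<close> open in
  Euclidean \<open>q\<close>-space; the lamination it defines is the maximal atlas containing them. The
  existence of these charts makes the (Polish) ambient space an \<open>(n + q)\<close>-manifold.
\<close>

definition foliated_manifold :: "nat \<Rightarrow> nat \<Rightarrow> 'a::topological_space chart set \<Rightarrow> bool" where
  "foliated_manifold n q F \<longleftrightarrow>
     lamination n F \<and> (\<forall>p. \<exists>c\<in>F. p \<in> fst c \<and> openin (Euclidean_space q) (chart_base c))"


section \<open>Leaves\<close>

definition plaques :: "'a chart set \<Rightarrow> 'a set set" where
  "plaques F = {{y \<in> fst c. chart_proj c y = s} | c s. c \<in> F \<and> s \<in> chart_base c}"

definition leaf_topology :: "'a chart set \<Rightarrow> 'a topology" where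
  "leaf_topology F = topology_generated_by (plaques F)"

definition leaves :: "'a chart set \<Rightarrow> 'a set set" where
  "leaves F = connected_components_of (leaf_topology F)"

definition minimal_lamination :: "'a::topological_space chart set \<Rightarrow> bool" where
  "minimal_lamination F \<longleftrightarrow> (\<forall>L\<in>leaves F. closure L = UNIV)"

text \<open>Since a lamination is a maximal atlas, the charts inside \<open>U\<close> form the maximal atlas of \<open>U\<close>.\<close>

definition restrict_lamination :: "'a chart set \<Rightarrow> 'a set \<Rightarrow> 'a chart set" where
  "restrict_lamination F U = {c \<in> F. fst c \<subseteq> U}"


section \<open>Transversals and holonomy\<close>

definition local_homeomorphism ::
    "'a::topological_space set \<Rightarrow> 'b::topological_space set \<Rightarrow> ('a \<Rightarrow> 'b) \<Rightarrow> bool" where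
  "local_homeomorphism A B f \<longleftrightarrow>
     (\<forall>x\<in>A. \<exists>V W g. x \<in> V \<and> openin (top_of_set A) V \<and> openin (top_of_set B) W \<and>
        homeomorphism V W f g)"

definition transversal :: "'a::topological_space chart set \<Rightarrow> 'a set \<Rightarrow> bool" where
  "transversal F T \<longleftrightarrow>
     (\<forall>c\<in>F. local_homeomorphism (fst c \<inter> T) (chart_base c) (chart_proj c))"

definition complete_transversal :: "'a::topological_space chart set \<Rightarrow> 'a set \<Rightarrow> bool" where
  "complete_transversal F T \<longleftrightarrow> transversal F T \<and> (\<forall>L\<in>leaves F. T \<inter> L \<noteq> {})"

text \<open>
  \<open>transverse_change c d V g\<close>: \<open>g\<close> is, on the open subset \<open>V\<close> of the base of \<open>c\<close>, the transverse
  component of the change of coordinates from \<open>c\<close> to \<open>d\<close>.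
\<close>

definition transverse_change ::
    "'a::topological_space chart \<Rightarrow> 'a chart \<Rightarrow> (nat \<Rightarrow> real) set \<Rightarrow>
      ((nat \<Rightarrow> real) \<Rightarrow> (nat \<Rightarrow> real)) \<Rightarrow> bool" where
  "transverse_change c d V g \<longleftrightarrow>
     (\<exists>W. open W \<and> W \<subseteq> fst c \<inter> fst d \<and> V = chart_proj c ` W \<and>
        (\<forall>y\<in>W. chart_proj d y = g (chart_proj c y)))"

text \<open>
  \<open>holonomy_chain F c d V \<gamma>\<close>: on the open subset \<open>V\<close> of the base of \<open>c\<close>, the map \<open>\<gamma>\<close> into the base
  of \<open>d\<close> is a composite of transverse changes of coordinates. As the inverse of a transverse
  change is locally a transverse change, these composites give all the germs of the pseudogroup
  which the changes generate on the disjoint union of the bases. The whole maximal atlas is used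
  instead of a regular one; the pseudogroups are equivalent.
\<close>

inductive holonomy_chain ::
    "'a::topological_space chart set \<Rightarrow> 'a chart \<Rightarrow> 'a chart \<Rightarrow> (nat \<Rightarrow> real) set \<Rightarrow>
      ((nat \<Rightarrow> real) \<Rightarrow> (nat \<Rightarrow> real)) \<Rightarrow> bool"
  for F where
  holonomy_chain_id:
    "\<lbrakk>c \<in> F; openin (top_of_set (chart_base c)) V\<rbrakk> \<Longrightarrow> holonomy_chain F c c V (\<lambda>s. s)"
| holonomy_chain_step:
    "\<lbrakk>holonomy_chain F c d V \<gamma>; e \<in> F; transverse_change d e W g;
      openin (top_of_set (chart_base c)) V'; V' \<subseteq> V; \<gamma> ` V' \<subseteq> W\<rbrakk>
     \<Longrightarrow> holonomy_chain F c e V' (g \<circ> \<gamma>)"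

text \<open>
  The local transformations \<open>h : V \<rightarrow> V'\<close> of the representative of the holonomy pseudogroup on a
  transversal \<open>T\<close>: read through the local homeomorphisms \<open>chart_proj c : fst c \<inter> T \<rightarrow> chart_base c\<close>,
  they are locally holonomy chains.
\<close>

definition holonomy_transformation ::
    "'a::topological_space chart set \<Rightarrow> 'a set \<Rightarrow> 'a set \<Rightarrow> 'a set \<Rightarrow> ('a \<Rightarrow> 'a) \<Rightarrow> bool" where
  "holonomy_transformation F T V V' h \<longleftrightarrow>
     openin (top_of_set T) V \<and> openin (top_of_set T) V' \<and> (\<exists>k. homeomorphism V V' h k) \<and>
     (\<forall>x\<in>V. \<exists>N c d \<gamma>. openin (top_of_set T) N \<and> x \<in> N \<and> N \<subseteq> V \<and>
        c \<in> F \<and> d \<in> F \<and> N \<subseteq> fst c \<and> h ` N \<subseteq> fst d \<and>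
        holonomy_chain F c d (chart_proj c ` N) \<gamma> \<and>
        (\<forall>y\<in>N. chart_proj d (h y) = \<gamma> (chart_proj c y)))"


section \<open>Transverse invariant measures\<close>

text \<open>
  A transverse invariant measure is given on a complete transversal \<open>T = space \<Lambda>\<close>, with its
  Borel sets.
\<close>

definition transverse_invariant_measure ::
    "'a::topological_space chart set \<Rightarrow> 'a measure \<Rightarrow> bool" where
  "transverse_invariant_measure F \<Lambda> \<longleftrightarrow>
     complete_transversal F (space \<Lambda>) \<and> sets \<Lambda> = sets (restrict_space borel (space \<Lambda>)) \<and>
     (\<forall>V V' h. holonomy_transformation F (space \<Lambda>) V V' h \<longrightarrow>
        (\<forall>B\<in>sets \<Lambda>. B \<subseteq> V \<longrightarrow> emeasure \<Lambda> (h ` B) = emeasure \<Lambda> B))"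

definition regular_measure :: "'a::topological_space measure \<Rightarrow> bool" where
  "regular_measure \<Lambda> \<longleftrightarrow>
     (\<forall>B\<in>sets \<Lambda>.
        emeasure \<Lambda> B = (INF V\<in>{V. openin (top_of_set (space \<Lambda>)) V \<and> B \<subseteq> V}. emeasure \<Lambda> V) \<and>
        emeasure \<Lambda> B = (SUP K\<in>{K. compact K \<and> K \<subseteq> B}. emeasure \<Lambda> K))"

text \<open>
  Atoms are points of positive measure. A singleton of positive measure is also an atom in the
  sense of measure theory, so this is the weaker form of the hypothesis; for regular measures on
  Polish spaces the two agree.
\<close>

definition without_atoms :: "'a measure \<Rightarrow> bool" where
  "without_atoms \<Lambda> \<longleftrightarrow> (\<forall>x\<in>space \<Lambda>. emeasure \<Lambda> {x} = 0)"

definition leafwise_measurable_iso ::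
    "'a::topological_space chart set \<Rightarrow> 'a set \<Rightarrow> 'a set \<Rightarrow> ('a \<Rightarrow> 'a) \<Rightarrow> bool" where
  "leafwise_measurable_iso F A B f \<longleftrightarrow>
     A \<in> sets borel \<and> B \<in> sets borel \<and> bij_betw f A B \<and>
     f \<in> measurable (restrict_space borel A) (restrict_space borel B) \<and>
     the_inv_into A f \<in> measurable (restrict_space borel B) (restrict_space borel A) \<and>
     (\<forall>x\<in>A. \<exists>L\<in>leaves F. x \<in> L \<and> f x \<in> L)"

text \<open>
  The extension of \<open>\<Lambda>\<close> to transverse sets: cut \<open>B\<close> into countably many measurable pieces \<open>P i\<close>,
  move each into the transversal \<open>space \<Lambda>\<close> by a measurable transformation \<open>f i\<close> keeping every
  point in its leaf, and add the measures of the images. A leafwise measurable transformation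
  between subsets of the transversal is piecewise a holonomy transformation, so for an invariant
  \<open>\<Lambda>\<close> all these sums agree and the infimum is just their common value. Such a decomposition
  exists for every transverse set, by Lusin--Novikov uniformization, and for no other set (there
  the value is \<open>\<infinity>\<close>).
\<close>

definition transverse_ext ::
    "'a::topological_space chart set \<Rightarrow> 'a measure \<Rightarrow> 'a set \<Rightarrow> ennreal" where
  "transverse_ext F \<Lambda> B =
     (INF (P, f)\<in>{(P :: nat \<Rightarrow> 'a set, f :: nat \<Rightarrow> 'a \<Rightarrow> 'a).
          disjoint_family P \<and> (\<Union>i. P i) = B \<and>
          (\<forall>i. f i ` P i \<subseteq> space \<Lambda> \<and> leafwise_measurable_iso F (P i) (f i ` P i) (f i))}.
        (\<Sum>i. emeasure \<Lambda> (f i ` P i)))"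


section \<open>The \<open>\<Lambda>\<close>-category\<close>

definition tangential_deformation ::
    "'a::topological_space chart set \<Rightarrow> 'a set \<Rightarrow> ('a \<times> real \<Rightarrow> 'a) \<Rightarrow> bool" where
  "tangential_deformation F U H \<longleftrightarrow>
     continuous_on (U \<times> UNIV) H \<and>
     (\<forall>L\<in>leaves (restrict_lamination F U). \<exists>L'\<in>leaves F. H ` (L \<times> UNIV) \<subseteq> L') \<and>
     (\<forall>x\<in>U. H (x, 0) = x)"

definition tangential_contraction ::
    "'a::topological_space chart set \<Rightarrow> 'a set \<Rightarrow> ('a \<times> real \<Rightarrow> 'a) \<Rightarrow> bool" where
  "tangential_contraction F U H \<longleftrightarrow>
     tangential_deformation F U H \<and>
     (\<forall>L\<in>leaves (restrict_lamination F U). (\<lambda>x. H (x, 1)) constant_on L)"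

definition tangentially_categorical :: "'a::topological_space chart set \<Rightarrow> 'a set \<Rightarrow> bool" where
  "tangentially_categorical F U \<longleftrightarrow> open U \<and> (\<exists>H. tangential_contraction F U H)"

definition tau :: "'a::topological_space chart set \<Rightarrow> 'a measure \<Rightarrow> 'a set \<Rightarrow> ennreal" where
  "tau F \<Lambda> U = (INF H\<in>{H. tangential_contraction F U H}. transverse_ext F \<Lambda> (H ` (U \<times> {1})))"

definition Cat :: "'a::topological_space chart set \<Rightarrow> 'a measure \<Rightarrow> ennreal" where
  "Cat F \<Lambda> =
     (INF \<V>\<in>{\<V>. (\<forall>U\<in>\<V>. tangentially_categorical F U) \<and> \<Union>\<V> = UNIV}. \<Sum>\<^sub>\<infinity>U\<in>\<V>. tau F \<Lambda> U)"

end

theory Submission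
  imports Defs
begin

text \<open>
  Points are contracted into the transversal \<open>T\<close> on which \<open>\<Lambda>\<close> is given, and the category is
  bounded by the \<open>\<Lambda>\<close>-measure of the open subsets \<open>N\<close> of \<open>T\<close> in which the contractions end
  (\<open>tau_le_emeasure\<close>). What makes the bound small is that the number of pieces being contracted
  is irrelevant: disjoint open sets which all contract into \<open>N\<close> have a union which contracts
  into \<open>N\<close>.

  Minimality makes every target available. The points with a neighbourhood contracting along
  the leaves into a given nonempty open \<open>N \<subseteq> T\<close> form a nonempty open union of leaves, because
  a contraction of a neighbourhood of \<open>x\<close> can be preceded by a slide along the plaques of a
  chart around \<open>x\<close>. A dense leaf meets this set, so it is everything (\<open>minimal_contraction\<close>).

  The measure makes disjointness available. Since \<open>\<Lambda>\<close> is outer regular without atoms, it is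
  finite near every point of \<open>T\<close>, and there are arbitrarily small balls around the point whose
  boundary sphere is null. Countably many such balls cover \<open>T\<close>; subtracting from each ball the
  earlier closed balls leaves disjoint open sets that cover \<open>T\<close> up to a null set, and their
  union \<open>D\<close> contracts into \<open>N\<close> (\<open>contracts_into_almost_everywhere\<close>). The null set \<open>T - D\<close>
  lies in an open subset \<open>V\<close> of \<open>T\<close> of small measure.

  Now let \<open>W\<close> be open with a contraction into \<open>T\<close>. The part of \<open>W\<close> arriving in \<open>D\<close> is moved on
  into \<open>N\<close>, and the part arriving in \<open>V\<close> is left there, so that \<open>W\<close> is the union of two
  categorical sets of arbitrarily small \<open>\<tau>\<^sub>\<Lambda>\<close> (\<open>contraction_small_pieces\<close>). Countably many such
  \<open>W\<close> cover the manifold, and the bounds for them can be chosen to have any given positive sum.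
\<close>

section \<open>Plaques\<close>

definition segment_point :: "(nat \<Rightarrow> real) \<Rightarrow> (nat \<Rightarrow> real) \<Rightarrow> real \<Rightarrow> nat \<Rightarrow> real" where
  "segment_point x y t = (\<lambda>i. (1 - t) * x i + t * y i)"

lemma segment_point_0 [simp]: "segment_point x y 0 = x"
  and segment_point_1 [simp]: "segment_point x y 1 = y"
  by (auto simp: segment_point_def)

lemma euclidean_ball_segment:
  assumes "x \<in> euclidean_ball n a r" "y \<in> euclidean_ball n a r" "0 \<le> t" "t \<le> 1"
  shows "segment_point x y t \<in> euclidean_ball n a r"
proof -
  let ?X = "L2_set (\<lambda>i. x i - a i) {..<n}" and ?Y = "L2_set (\<lambda>i. y i - a i) {..<n}"
  have xy: "?X < r" "?Y < r" using assms by (auto simp: euclidean_ball_def)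
  have "L2_set (\<lambda>i. segment_point x y t i - a i) {..<n}
      = L2_set (\<lambda>i. (1 - t) * (x i - a i) + t * (y i - a i)) {..<n}"
    by (rule L2_set_cong) (auto simp: segment_point_def algebra_simps)
  also have "\<dots> \<le> L2_set (\<lambda>i. (1 - t) * (x i - a i)) {..<n} + L2_set (\<lambda>i. t * (y i - a i)) {..<n}"
    by (rule L2_set_triangle_ineq)
  also have "\<dots> = (1 - t) * ?X + t * ?Y"
    using assms by (simp add: L2_set_right_distrib)
  also have "\<dots> < r"
    by (rule convex_bound_lt) (use xy assms in auto)
  finally have "L2_set (\<lambda>i. segment_point x y t i - a i) {..<n} < r" .
  then show ?thesis
    using assms by (auto simp: euclidean_ball_def topspace_Euclidean_space segment_point_def)
qed

lemma continuous_on_segment_point: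
  assumes "continuous_on A f" "continuous_on A g" "continuous_on A h"
  shows "continuous_on A (\<lambda>x. segment_point (f x) (g x) (h x))"
  unfolding segment_point_def
  by (rule continuous_on_coordinatewise_then_product)
     (intro continuous_intros assms continuous_on_product_then_coordinatewise[OF assms(1)]
        continuous_on_product_then_coordinatewise[OF assms(2)])

lemma center_in_euclidean_ball:
  assumes "a \<in> topspace (Euclidean_space n)" "r > 0"
  shows "a \<in> euclidean_ball n a r"
  using assms by (simp add: euclidean_ball_def L2_set_def)

lemma connected_euclidean_ball: "connected (euclidean_ball n a r)"
proof (rule path_connected_imp_connected)
  show "path_connected (euclidean_ball n a r)"
    unfolding path_connected_def
  proof (intro ballI)
    fix x y assume xy: "x \<in> euclidean_ball n a r" "y \<in> euclidean_ball n a r"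
    have "path (segment_point x y)"
      unfolding path_def by (intro continuous_on_segment_point continuous_intros)
    moreover have "path_image (segment_point x y) \<subseteq> euclidean_ball n a r"
      using euclidean_ball_segment[OF xy] by (auto simp: path_image_def)
    ultimately show "\<exists>g. path g \<and> path_image g \<subseteq> euclidean_ball n a r \<and>
        pathstart g = x \<and> pathfinish g = y"
      by (intro exI[of _ "segment_point x y"]) (simp add: pathstart_def pathfinish_def)
  qed
qed

text \<open>The ball is nonempty, so the transverse factor of a chart is recovered as its base.\<close>

lemma foliated_chart_homeomorphism:
  assumes "foliated_chart n c"
  obtains a r \<psi> where "a \<in> euclidean_ball n a r" "open (fst c)"
    "homeomorphism (fst c) (euclidean_ball n a r \<times> chart_base c) (snd c) \<psi>"
proof -
  obtain a r S \<psi> where *: "a \<in> topspace (Euclidean_space n)" "r > 0" "open (fst c)"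
    "homeomorphism (fst c) (euclidean_ball n a r \<times> S) (snd c) \<psi>"
    using assms by (auto simp: foliated_chart_def)
  have a: "a \<in> euclidean_ball n a r" using * center_in_euclidean_ball by blast
  have "chart_base c = snd ` (snd c ` fst c)"
    by (auto simp: chart_base_def chart_proj_def)
  also have "\<dots> = S" using *(4) a by (auto simp: homeomorphism_def)
  finally show thesis using that * a by auto
qed

lemma continuous_on_chart_proj:
  assumes "foliated_chart n c"
  shows "continuous_on (fst c) (chart_proj c)"
proof -
  obtain a r \<psi> where "homeomorphism (fst c) (euclidean_ball n a r \<times> chart_base c) (snd c) \<psi>"
    using foliated_chart_homeomorphism[OF assms] by metis
  then have "continuous_on (fst c) (snd c)" by (auto simp: homeomorphism_def)
  then show ?thesis unfolding chart_proj_def [abs_def] by (intro continuous_on_snd)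
qed

lemma connected_plaque:
  assumes "foliated_chart n c" "s \<in> chart_base c"
  shows "connected {y \<in> fst c. chart_proj c y = s}"
proof -
  obtain a r \<psi> where h: "homeomorphism (fst c) (euclidean_ball n a r \<times> chart_base c) (snd c) \<psi>"
    using foliated_chart_homeomorphism[OF assms(1)] by metis
  have "{y \<in> fst c. chart_proj c y = s} = \<psi> ` (euclidean_ball n a r \<times> {s})" (is "?P = ?Q")
  proof
    show "?P \<subseteq> ?Q"
    proof
      fix y assume y: "y \<in> ?P"
      then have "snd c y \<in> euclidean_ball n a r \<times> chart_base c" "\<psi> (snd c y) = y"
        using h by (auto simp: homeomorphism_def)
      then show "y \<in> ?Q"
        using y by (intro image_eqI[of _ _ "snd c y"]) (auto simp: chart_proj_def mem_Times_iff)
    qed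
    show "?Q \<subseteq> ?P"
      using h assms(2) by (force simp: homeomorphism_def chart_proj_def)
  qed
  moreover have "connected \<dots>"
  proof (rule connected_continuous_image)
    show "continuous_on (euclidean_ball n a r \<times> {s}) \<psi>"
      by (rule continuous_on_subset[of "euclidean_ball n a r \<times> chart_base c"])
        (use h assms(2) in \<open>auto simp: homeomorphism_def\<close>)
  qed (simp add: connected_Times connected_euclidean_ball)
  ultimately show ?thesis by simp
qed

lemma compatible_charts_proj:
  assumes "foliated_atlas n F" "c \<in> F" "d \<in> F" "p \<in> fst c \<inter> fst d"
  obtains W where "open W" "p \<in> W" "W \<subseteq> fst c \<inter> fst d"
    "\<forall>y\<in>W. chart_proj c y = chart_proj c p \<longrightarrow> chart_proj d y = chart_proj d p"
proof -
  have "compatible_charts c d" using assms by (simp add: foliated_atlas_def)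
  from this[unfolded compatible_charts_def, THEN bspec, OF assms(4)]
  obtain W f g where W: "open W" "p \<in> W" "W \<subseteq> fst c \<inter> fst d"
      "\<forall>y\<in>W. \<forall>x s. snd c y = (x, s) \<longrightarrow> snd d y = (f (x, s), g s)"
    by (elim exE conjE) (rule that)
  have "chart_proj d y = g (chart_proj c y)" if "y \<in> W" for y
    using W(4)[rule_format, OF that, of "fst (snd c y)" "snd (snd c y)"]
    by (simp add: chart_proj_def)
  then show thesis using W(1-3) that[of W] by auto
qed

lemma topspace_leaf_topology: "topspace (leaf_topology F) = (\<Union>c\<in>F. fst c)"
proof -
  have "\<Union>(plaques F) = (\<Union>c\<in>F. fst c)"
  proof
    show "(\<Union>c\<in>F. fst c) \<subseteq> \<Union>(plaques F)"
    proof safe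
      fix c :: "'a chart" and y
      assume "c \<in> F" "y \<in> fst c"
      then have "{z \<in> fst c. chart_proj c z = chart_proj c y} \<in> plaques F"
        unfolding plaques_def chart_base_def by blast
      with \<open>y \<in> fst c\<close> show "y \<in> \<Union>(plaques F)" by blast
    qed
  qed (auto simp: plaques_def)
  then show ?thesis by (simp add: leaf_topology_def)
qed

text \<open>
  The level sets of \<open>p\<close> are unions of plaques, hence open in the leaf topology, and a connected
  set lies in one of them. Every statement below about whole leaves is reduced to plaques in this
  way.
\<close>

lemma constant_on_plaques_imp_leaves:
  assumes "\<And>P. P \<in> plaques F \<Longrightarrow> p constant_on P" "L \<in> leaves F"
  shows "p constant_on L"
proof -
  let ?X = "leaf_topology F"
  \<comment> \<open>For every property \<open>Q\<close>, so that a level set and its complement are both covered.\<close>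
  have op: "openin ?X {x \<in> topspace ?X. Q (p x)}" for Q
  proof -
    have "{x \<in> topspace ?X. Q (p x)} = \<Union>{P \<in> plaques F. \<forall>x\<in>P. Q (p x)}"
    proof safe
      fix x assume "x \<in> topspace ?X" and Q: "Q (p x)"
      then obtain P where P: "P \<in> plaques F" "x \<in> P"
        by (auto simp: leaf_topology_def)
      have "\<forall>z\<in>P. Q (p z)"
        using assms(1)[OF P(1)] P(2) Q by (metis constant_on_def)
      then show "x \<in> \<Union>{P \<in> plaques F. \<forall>x\<in>P. Q (p x)}" using P by blast
    qed (auto simp: leaf_topology_def)
    moreover have "openin ?X \<dots>"
      by (intro openin_Union) (auto simp: leaf_topology_def intro: topology_generated_by_Basis)
    ultimately show ?thesis by simp
  qed
  have con: "connectedin ?X L"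
    using assms(2) by (auto simp: leaves_def intro: connectedin_connected_components_of)
  show ?thesis
  proof (rule ccontr)
    assume "\<not> p constant_on L"
    then obtain y z where yz: "y \<in> L" "z \<in> L" "p y \<noteq> p z" by (metis constant_on_def)
    have "L \<subseteq> topspace ?X" using con by (rule connectedin_subset_topspace)
    then have "L \<subseteq> {x \<in> topspace ?X. p x = p y} \<union> {x \<in> topspace ?X. p x \<noteq> p y}"
      "{x \<in> topspace ?X. p x = p y} \<inter> {x \<in> topspace ?X. p x \<noteq> p y} \<inter> L = {}"
      "{x \<in> topspace ?X. p x = p y} \<inter> L \<noteq> {}" "{x \<in> topspace ?X. p x \<noteq> p y} \<inter> L \<noteq> {}"
      using yz by fastforce+
    then show False
      using con op[of "\<lambda>v. v = p y"] op[of "\<lambda>v. v \<noteq> p y"]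
      unfolding connectedin by metis
  qed
qed

text \<open>
  Compatible charts have the same plaques locally, so the intersection of two plaques is
  relatively open in both. Hence the leaf topology induces on a plaque nothing finer than the
  ambient topology.
\<close>

lemma openin_leaf_topology_Int_plaque:
  assumes at: "foliated_atlas n F" and P: "P \<in> plaques F" and U: "openin (leaf_topology F) U"
  shows "openin (top_of_set P) (U \<inter> P)"
proof -
  have "generate_topology_on (plaques F) U"
    using U by (simp add: leaf_topology_def openin_topology_generated_by_iff)
  then show ?thesis
  proof induction
    case Empty
    show ?case by simp
  next
    case (Int A B)
    have "openin (top_of_set P) ((A \<inter> P) \<inter> (B \<inter> P))" by (rule openin_Int[OF Int.IH])
    moreover have "(A \<inter> P) \<inter> (B \<inter> P) = A \<inter> B \<inter> P" by blast
    ultimately show ?case by simp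
  next
    case (UN K)
    have "openin (top_of_set P) (\<Union>k\<in>K. k \<inter> P)" by (intro openin_Union) (use UN.IH in blast)
    moreover have "(\<Union>k\<in>K. k \<inter> P) = \<Union>K \<inter> P" by blast
    ultimately show ?case by simp
  next
    case (Basis Q)
    obtain c s where c: "c \<in> F" "P = {y \<in> fst c. chart_proj c y = s}"
      using P by (auto simp: plaques_def)
    obtain d t where d: "d \<in> F" "Q = {y \<in> fst d. chart_proj d y = t}"
      using Basis by (auto simp: plaques_def)
    show ?case
    proof (subst openin_subopen, safe)
      fix x assume x: "x \<in> Q" "x \<in> P"
      then have xcd: "x \<in> fst c \<inter> fst d" using c d by auto
      obtain W where W: "open W" "x \<in> W" "W \<subseteq> fst c \<inter> fst d"
        "\<forall>y\<in>W. chart_proj c y = chart_proj c x \<longrightarrow> chart_proj d y = chart_proj d x"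
        by (rule compatible_charts_proj[OF at c(1) d(1) xcd]) blast
      have "openin (top_of_set P) (P \<inter> W)" using W(1) by (simp add: openin_open_Int)
      moreover have "P \<inter> W \<subseteq> Q \<inter> P"
      proof
        fix y assume y: "y \<in> P \<inter> W"
        then have "chart_proj d y = chart_proj d x" using W(4) x c(2) by simp
        then show "y \<in> Q \<inter> P" using y x d(2) W(3) by auto
      qed
      ultimately show "\<exists>T. openin (top_of_set P) T \<and> x \<in> T \<and> T \<subseteq> Q \<inter> P" using x W(2) by blast
    qed
  qed
qed

text \<open>
  A plaque is a copy of a ball, hence connected in the ambient topology, and a separation in the
  leaf topology would be one in the ambient topology.
\<close>

lemma connectedin_plaque:
  assumes at: "foliated_atlas n F" and P: "P \<in> plaques F"
  shows "connectedin (leaf_topology F) P"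
proof -
  obtain c s where c: "c \<in> F" "s \<in> chart_base c" "P = {y \<in> fst c. chart_proj c y = s}"
    using P by (auto simp: plaques_def)
  have "foliated_chart n c" using at c(1) by (simp add: foliated_atlas_def)
  then have "connected P" using c(2) unfolding c(3) by (rule connected_plaque)
  then have *: "\<not> (openin (top_of_set P) A \<and> openin (top_of_set P) B \<and> P \<subseteq> A \<union> B \<and>
      A \<inter> B = {} \<and> A \<noteq> {} \<and> B \<noteq> {})" for A B
    unfolding connected_openin by blast
  have sub: "P \<subseteq> topspace (leaf_topology F)"
    using P unfolding leaf_topology_def topology_generated_by_topspace by blast
  show ?thesis
  proof (subst connectedin, intro conjI sub notI, elim exE conjE)
    fix A B
    assume A: "openin (leaf_topology F) A" and B: "openin (leaf_topology F) B"
      and cov: "P \<subseteq> A \<union> B" and dis: "A \<inter> B \<inter> P = {}"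
      and ne: "A \<inter> P \<noteq> {}" "B \<inter> P \<noteq> {}"
    have "P \<subseteq> (A \<inter> P) \<union> (B \<inter> P)" "(A \<inter> P) \<inter> (B \<inter> P) = {}"
      using cov dis by auto
    then show False
      using *[of "A \<inter> P" "B \<inter> P"] ne openin_leaf_topology_Int_plaque[OF at P A]
        openin_leaf_topology_Int_plaque[OF at P B]
      by metis
  qed
qed

section \<open>Leafwise contractions\<close>

text \<open>
  A local substitute for being constant on the leaves of \<open>\<F>\<^sub>U\<close>. It involves all charts of the
  lamination, not only those inside \<open>U\<close>, which makes it pass to smaller sets and to composites.
\<close>

definition locally_constant_on_plaques ::
    "'a::topological_space chart set \<Rightarrow> 'a set \<Rightarrow> ('a \<Rightarrow> 'b) \<Rightarrow> bool" where
  "locally_constant_on_plaques F U p \<longleftrightarrow>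
     (\<forall>c\<in>F. \<forall>y\<in>U \<inter> fst c. \<exists>W. open W \<and> y \<in> W \<and>
        (\<forall>z\<in>W \<inter> U \<inter> fst c. chart_proj c z = chart_proj c y \<longrightarrow> p z = p y))"

text \<open>
  Tangential contractions in pointwise form: each point moves within its own leaf of the whole
  lamination, and no leaf of the restriction to \<open>U\<close> is mentioned. This form is stable under the
  constructions needed, and it implies the original one.
\<close>

definition leafwise_contraction ::
    "'a::topological_space chart set \<Rightarrow> 'a set \<Rightarrow> ('a \<times> real \<Rightarrow> 'a) \<Rightarrow> bool" where
  "leafwise_contraction F U H \<longleftrightarrow>
     open U \<and> continuous_on (U \<times> UNIV) H \<and> (\<forall>x\<in>U. H (x, 0) = x) \<and>
     (\<forall>x\<in>U. \<forall>t. connected_component_of (leaf_topology F) x (H (x, t))) \<and>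
     locally_constant_on_plaques F U (\<lambda>x. H (x, 1))"

lemma connected_component_of_plaque:
  assumes "foliated_atlas n F" "c \<in> F" "x \<in> fst c" "y \<in> fst c" "chart_proj c x = chart_proj c y"
  shows "connected_component_of (leaf_topology F) x y"
proof -
  have "{z \<in> fst c. chart_proj c z = chart_proj c y} \<in> plaques F" (is "?P \<in> _")
    using assms unfolding plaques_def chart_base_def by blast
  then have "connectedin (leaf_topology F) ?P" using assms(1) by (intro connectedin_plaque)
  moreover have "x \<in> ?P" "y \<in> ?P" using assms by auto
  ultimately show ?thesis unfolding connected_component_of_def by blast
qed

lemma topspace_leaf_topology_atlas:
  "foliated_atlas n F \<Longrightarrow> topspace (leaf_topology F) = UNIV"
  by (simp add: topspace_leaf_topology foliated_atlas_def)

lemma locally_constant_on_plaques_subset: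
  assumes "locally_constant_on_plaques F U p" "V \<subseteq> U"
  shows "locally_constant_on_plaques F V p"
  unfolding locally_constant_on_plaques_def
proof (intro ballI)
  fix c y assume "c \<in> F" "y \<in> V \<inter> fst c"
  then obtain W where "open W" "y \<in> W"
    "\<forall>z\<in>W \<inter> U \<inter> fst c. chart_proj c z = chart_proj c y \<longrightarrow> p z = p y"
    using assms unfolding locally_constant_on_plaques_def by blast
  then show "\<exists>W. open W \<and> y \<in> W \<and>
      (\<forall>z\<in>W \<inter> V \<inter> fst c. chart_proj c z = chart_proj c y \<longrightarrow> p z = p y)"
    using assms(2) by blast
qed

lemma locally_constant_on_plaques_compose:
  assumes "locally_constant_on_plaques F U p" "\<And>x. x \<in> U \<Longrightarrow> q x = g (p x)"
  shows "locally_constant_on_plaques F U q"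
  unfolding locally_constant_on_plaques_def
proof (intro ballI)
  fix c y assume y: "c \<in> F" "y \<in> U \<inter> fst c"
  then obtain W where "open W" "y \<in> W"
    and W: "\<forall>z\<in>W \<inter> U \<inter> fst c. chart_proj c z = chart_proj c y \<longrightarrow> p z = p y"
    using assms(1) unfolding locally_constant_on_plaques_def by blast
  moreover have "q z = q y" if "z \<in> W \<inter> U \<inter> fst c" "chart_proj c z = chart_proj c y" for z
  proof -
    have "p z = p y" using W that by blast
    then show ?thesis using that y assms(2)[of z] assms(2)[of y] by simp
  qed
  ultimately show "\<exists>W. open W \<and> y \<in> W \<and>
      (\<forall>z\<in>W \<inter> U \<inter> fst c. chart_proj c z = chart_proj c y \<longrightarrow> q z = q y)"
    by blast
qed

lemma locally_constant_on_plaques_chart_proj: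
  assumes "foliated_atlas n F" "c \<in> F" "U \<subseteq> fst c"
  shows "locally_constant_on_plaques F U (chart_proj c)"
  unfolding locally_constant_on_plaques_def
proof (intro ballI)
  fix d y assume d: "d \<in> F" and y: "y \<in> U \<inter> fst d"
  then have "y \<in> fst d \<inter> fst c" using assms by auto
  then obtain W where "open W" "y \<in> W" "W \<subseteq> fst d \<inter> fst c"
    "\<forall>z\<in>W. chart_proj d z = chart_proj d y \<longrightarrow> chart_proj c z = chart_proj c y"
    by (rule compatible_charts_proj[OF assms(1) d assms(2)])
  then show "\<exists>W. open W \<and> y \<in> W \<and>
      (\<forall>z\<in>W \<inter> U \<inter> fst d. chart_proj d z = chart_proj d y \<longrightarrow> chart_proj c z = chart_proj c y)"
    by blast
qed

lemma locally_constant_on_plaques_imp_constant: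
  assumes at: "foliated_atlas n F" and p: "locally_constant_on_plaques F U p"
    and P: "P \<in> plaques (restrict_lamination F U)"
  shows "p constant_on P"
proof -
  obtain c s where c: "c \<in> F" "fst c \<subseteq> U" "s \<in> chart_base c"
    "P = {y \<in> fst c. chart_proj c y = s}"
    using P by (auto simp: plaques_def restrict_lamination_def)
  have "foliated_chart n c" using at c(1) by (simp add: foliated_atlas_def)
  then have "connected P" using c(3) unfolding c(4) by (rule connected_plaque)
  then show ?thesis
  proof (rule locally_constant_imp_constant)
    fix y assume y: "y \<in> P"
    then have "y \<in> U \<inter> fst c" using c by auto
    then obtain W where W: "open W" "y \<in> W"
      "\<forall>z\<in>W \<inter> U \<inter> fst c. chart_proj c z = chart_proj c y \<longrightarrow> p z = p y"
      using p c(1) unfolding locally_constant_on_plaques_def by blast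
    have "openin (top_of_set P) (P \<inter> W)" using W(1) by (simp add: openin_open_Int)
    moreover have "\<forall>z\<in>P \<inter> W. p z = p y"
    proof
      fix z assume z: "z \<in> P \<inter> W"
      then show "p z = p y" using W(3) y unfolding c(4) using c(2) by auto
    qed
    ultimately show "\<exists>T. openin (top_of_set P) T \<and> y \<in> T \<and> (\<forall>x\<in>T. p x = p y)"
      using y W(2) by blast
  qed
qed

text \<open>
  The map sending a point to its leaf in \<open>\<F>\<close> is constant on the plaques of \<open>\<F>\<^sub>U\<close>, which are
  connected in the leaf topology of \<open>\<F>\<close>; therefore it is constant on the leaves of \<open>\<F>\<^sub>U\<close>.
\<close>

lemma leaf_of_restriction:
  assumes at: "foliated_atlas n F" and L: "L \<in> leaves (restrict_lamination F U)"
  obtains x where "x \<in> L" "L \<subseteq> U"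
    "\<forall>y\<in>L. connected_component_of (leaf_topology F) x y"
proof -
  let ?q = "\<lambda>x. connected_component_of_set (leaf_topology F) x"
  have "?q constant_on P" if "P \<in> plaques (restrict_lamination F U)" for P
  proof -
    have "P \<in> plaques F" using that unfolding plaques_def restrict_lamination_def by blast
    then have "connectedin (leaf_topology F) P" by (rule connectedin_plaque[OF at])
    then have "connected_component_of (leaf_topology F) x y" if "x \<in> P" "y \<in> P" for x y
      using that unfolding connected_component_of_def by blast
    then show ?thesis
      unfolding constant_on_def by (metis connected_component_of_equiv)
  qed
  then have const: "?q constant_on L"
    by (rule constant_on_plaques_imp_leaves[OF _ L])
  have "L \<noteq> {}" using L unfolding leaves_def by (rule nonempty_connected_components_of)
  then obtain x where x: "x \<in> L" by blast
  have "L \<subseteq> topspace (leaf_topology (restrict_lamination F U))"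
    using L unfolding leaves_def by (rule connected_components_of_subset)
  then have "L \<subseteq> U" by (auto simp: topspace_leaf_topology restrict_lamination_def)
  moreover have "connected_component_of (leaf_topology F) x y" if "y \<in> L" for y
  proof -
    have "?q x = ?q y" using const x that by (metis constant_on_def)
    moreover have "connected_component_of (leaf_topology F) y y"
      by (simp add: connected_component_of_refl topspace_leaf_topology_atlas[OF at])
    ultimately show ?thesis by blast
  qed
  ultimately show thesis using x that by blast
qed

lemma leaf_of_point_in_leaves:
  assumes "foliated_atlas n F"
  shows "connected_component_of_set (leaf_topology F) x \<in> leaves F"
  by (simp add: leaves_def connected_components_of_def topspace_leaf_topology_atlas[OF assms])

lemma leafwise_contraction_imp_tangential:
  assumes at: "foliated_atlas n F" and H: "leafwise_contraction F U H"
  shows "tangential_contraction F U H"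
  unfolding tangential_contraction_def tangential_deformation_def
proof (intro conjI ballI)
  show "continuous_on (U \<times> UNIV) H" "\<And>x. x \<in> U \<Longrightarrow> H (x, 0) = x"
    using H by (auto simp: leafwise_contraction_def)
next
  fix L assume L: "L \<in> leaves (restrict_lamination F U)"
  obtain x where x: "x \<in> L" "L \<subseteq> U" "\<forall>y\<in>L. connected_component_of (leaf_topology F) x y"
    using leaf_of_restriction[OF at L] .
  have "connected_component_of (leaf_topology F) x (H (y, t))" if "y \<in> L" for y t
  proof (rule connected_component_of_trans)
    show "connected_component_of (leaf_topology F) x y" using x that by blast
    show "connected_component_of (leaf_topology F) y (H (y, t))"
      using H x(2) that by (auto simp: leafwise_contraction_def)
  qed
  then show "\<exists>L'\<in>leaves F. H ` (L \<times> UNIV) \<subseteq> L'"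
    by (intro bexI[OF _ leaf_of_point_in_leaves[OF at, of x]]) auto
next
  fix L assume L: "L \<in> leaves (restrict_lamination F U)"
  from L show "(\<lambda>x. H (x, 1)) constant_on L"
  proof (rule constant_on_plaques_imp_leaves[rotated])
    fix P assume "P \<in> plaques (restrict_lamination F U)"
    then show "(\<lambda>x. H (x, 1)) constant_on P"
      using H unfolding leafwise_contraction_def
      by (intro locally_constant_on_plaques_imp_constant[OF at]) auto
  qed
qed

lemma leafwise_contraction_restrict:
  assumes "leafwise_contraction F U H" "open V" "V \<subseteq> U"
  shows "leafwise_contraction F V H"
proof -
  have "continuous_on (V \<times> UNIV) H"
    by (rule continuous_on_subset[of "U \<times> UNIV"])
      (use assms in \<open>auto simp: leafwise_contraction_def\<close>)
  moreover have "locally_constant_on_plaques F V (\<lambda>x. H (x, 1))"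
    by (rule locally_constant_on_plaques_subset[of F U])
      (use assms in \<open>auto simp: leafwise_contraction_def\<close>)
  ultimately show ?thesis using assms unfolding leafwise_contraction_def by blast
qed

text \<open>
  Deformations are defined for all real times, so both can simply be run at double speed, the
  first up to time \<open>1/2\<close> and the second afterwards, starting where the first has arrived.
\<close>

lemma leafwise_contraction_concat:
  assumes H: "leafwise_contraction F U H" and G: "leafwise_contraction F D G"
  shows "\<exists>K. leafwise_contraction F {x \<in> U. H (x, 1) \<in> D} K \<and> (\<forall>x. K (x, 1) = G (H (x, 1), 1))"
proof -
  let ?V = "{x \<in> U. H (x, 1) \<in> D}"
  define K where "K = (\<lambda>z::'a \<times> real. if snd z \<le> 1/2 then H (fst z, 2 * snd z)
    else G (H (fst z, 1), 2 * snd z - 1))"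
  have Hc: "continuous_on (U \<times> UNIV) H" and Gc: "continuous_on (D \<times> UNIV) G"
    and UD: "open U" "open D"
    using H G by (auto simp: leafwise_contraction_def)
  have H1: "continuous_on U (\<lambda>x. H (x, 1))"
    by (rule continuous_on_compose2[OF Hc]) (auto intro!: continuous_intros)
  have "open (U \<inter> (\<lambda>x. H (x, 1)) -` D)"
    by (rule continuous_open_preimage[OF H1 UD])
  moreover have "U \<inter> (\<lambda>x. H (x, 1)) -` D = ?V" by auto
  ultimately have V: "open ?V" by simp
  have "continuous_on (?V \<times> UNIV) K"
    unfolding K_def
  proof (rule continuous_on_cases_le)
    show "continuous_on {z \<in> ?V \<times> UNIV. snd z \<le> 1 / 2} (\<lambda>z. H (fst z, 2 * snd z))"
      by (rule continuous_on_compose2[OF Hc]) (auto intro!: continuous_intros)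
    have "continuous_on {z \<in> ?V \<times> UNIV. 1 / 2 \<le> snd z} (\<lambda>z::'a \<times> real. H (fst z, 1))"
      by (rule continuous_on_compose2[OF Hc]) (auto intro!: continuous_intros)
    then show "continuous_on {z \<in> ?V \<times> UNIV. 1 / 2 \<le> snd z}
        (\<lambda>z. G (H (fst z, 1), 2 * snd z - 1))"
      by (intro continuous_on_compose2[OF Gc] continuous_intros) auto
    show "continuous_on (?V \<times> UNIV) (snd :: 'a \<times> real \<Rightarrow> real)"
      by (intro continuous_intros)
    show "H (fst z, 2 * snd z) = G (H (fst z, 1), 2 * snd z - 1)"
      if "z \<in> ?V \<times> UNIV" "snd z = 1 / 2" for z
    proof -
      have "G (H (fst z, 1), 0) = H (fst z, 1)"
        using that G by (auto simp: leafwise_contraction_def)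
      moreover have "2 * snd z = 1" "2 * snd z - 1 = 0" using that(2) by auto
      ultimately show ?thesis by (simp only:)
    qed
  qed
  moreover have "K (x, 0) = x" if "x \<in> ?V" for x
    using that H by (auto simp: K_def leafwise_contraction_def)
  moreover have "connected_component_of (leaf_topology F) x (K (x, t))" if "x \<in> ?V" for x t
  proof (cases "t \<le> 1/2")
    case True
    then show ?thesis using that H by (auto simp: K_def leafwise_contraction_def)
  next
    case False
    have "connected_component_of (leaf_topology F) x (H (x, 1))"
      "connected_component_of (leaf_topology F) (H (x, 1)) (G (H (x, 1), 2 * t - 1))"
      using that H G by (auto simp: leafwise_contraction_def)
    then have "connected_component_of (leaf_topology F) x (G (H (x, 1), 2 * t - 1))"
      by (rule connected_component_of_trans)
    then show ?thesis using False by (simp add: K_def)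
  qed
  moreover have "locally_constant_on_plaques F ?V (\<lambda>x. K (x, 1))"
  proof (rule locally_constant_on_plaques_compose)
    show "locally_constant_on_plaques F ?V (\<lambda>x. H (x, 1))"
      by (rule locally_constant_on_plaques_subset[of F U])
        (use H in \<open>auto simp: leafwise_contraction_def\<close>)
    show "K (x, 1) = (\<lambda>w. G (w, 1)) (H (x, 1))" for x by (simp add: K_def)
  qed
  ultimately have "leafwise_contraction F ?V K" using V by (simp add: leafwise_contraction_def)
  then show ?thesis by (intro exI[of _ K]) (simp add: K_def)
qed

text \<open>
  On disjoint open sets the deformations are independent of each other; in particular their
  ends may overlap, so a union of many pieces can end in the same small set as one of them.
\<close>

lemma leafwise_contraction_disjoint_union:
  assumes H: "\<And>k. k \<in> I \<Longrightarrow> leafwise_contraction F (U k) (H k)"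
    and dis: "disjoint_family_on U I"
  shows "\<exists>K. leafwise_contraction F (\<Union>k\<in>I. U k) K \<and> (\<forall>k\<in>I. \<forall>x\<in>U k. \<forall>t. K (x, t) = H k (x, t))"
proof -
  define K where "K = (\<lambda>z. H (SOME k. k \<in> I \<and> fst z \<in> U k) z)"
  have K: "K (x, t) = H k (x, t)" if "k \<in> I" "x \<in> U k" for x t k
  proof -
    have "(SOME k. k \<in> I \<and> x \<in> U k) = k"
      by (rule some_equality) (use that dis in \<open>auto simp: disjoint_family_on_def\<close>)
    then show ?thesis by (simp add: K_def)
  qed
  have op: "open (U k)" if "k \<in> I" for k using H[OF that] by (simp add: leafwise_contraction_def)
  have "continuous_on (\<Union>k\<in>I. U k \<times> UNIV) K"
  proof (rule continuous_on_open_UN)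
    fix k assume k: "k \<in> I"
    show "open (U k \<times> (UNIV :: real set))" using op[OF k] by (intro open_Times) auto
    have "continuous_on (U k \<times> UNIV) (H k)" using H[OF k] by (simp add: leafwise_contraction_def)
    then show "continuous_on (U k \<times> UNIV) K"
      by (rule continuous_on_eq) (use K[OF k] in auto)
  qed
  moreover have "(\<Union>k\<in>I. U k \<times> (UNIV :: real set)) = (\<Union>k\<in>I. U k) \<times> UNIV" by blast
  ultimately have "continuous_on ((\<Union>k\<in>I. U k) \<times> UNIV) K" by simp
  moreover have "locally_constant_on_plaques F (\<Union>k\<in>I. U k) (\<lambda>x. K (x, 1))"
    unfolding locally_constant_on_plaques_def
  proof (intro ballI)
    fix c y assume c: "c \<in> F" and "y \<in> (\<Union>k\<in>I. U k) \<inter> fst c"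
    then obtain k where k: "k \<in> I" "y \<in> U k \<inter> fst c" by blast
    have "locally_constant_on_plaques F (U k) (\<lambda>x. H k (x, 1))"
      using H[OF k(1)] by (simp add: leafwise_contraction_def)
    then obtain W where W: "open W" "y \<in> W"
      "\<forall>z\<in>W \<inter> U k \<inter> fst c. chart_proj c z = chart_proj c y \<longrightarrow> H k (z, 1) = H k (y, 1)"
      using c k(2) unfolding locally_constant_on_plaques_def by blast
    show "\<exists>W. open W \<and> y \<in> W \<and> (\<forall>z\<in>W \<inter> (\<Union>k\<in>I. U k) \<inter> fst c.
        chart_proj c z = chart_proj c y \<longrightarrow> K (z, 1) = K (y, 1))"
    proof (intro exI[of _ "W \<inter> U k"] conjI ballI impI)
      fix z assume z: "z \<in> W \<inter> U k \<inter> (\<Union>k\<in>I. U k) \<inter> fst c"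
        and eq: "chart_proj c z = chart_proj c y"
      then have "H k (z, 1) = H k (y, 1)" using W(3) by blast
      then show "K (z, 1) = K (y, 1)" using z k K[OF k(1)] by simp
    qed (use W k op[OF k(1)] in auto)
  qed
  moreover have "K (x, 0) = x \<and> (\<forall>t. connected_component_of (leaf_topology F) x (K (x, t)))"
    if "x \<in> (\<Union>k\<in>I. U k)" for x
  proof -
    from that obtain k where k: "k \<in> I" "x \<in> U k" by blast
    then show ?thesis using H[OF k(1)] K[OF k] by (simp add: leafwise_contraction_def)
  qed
  ultimately have "leafwise_contraction F (\<Union>k\<in>I. U k) K"
    using op by (auto simp: leafwise_contraction_def)
  then show ?thesis using K by blast
qed

text \<open>
  A section \<open>\<sigma>\<close> of the chart projection picks one point in each plaque over \<open>S\<close>; the ball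
  factor is convex, so each plaque contracts to that point along straight lines.
\<close>

lemma chart_contraction:
  assumes at: "foliated_atlas n F" and c: "c \<in> F"
    and S: "openin (top_of_set (chart_base c)) S"
    and \<sigma>: "continuous_on S \<sigma>" "\<And>s. s \<in> S \<Longrightarrow> \<sigma> s \<in> fst c \<and> chart_proj c (\<sigma> s) = s"
  shows "\<exists>H. leafwise_contraction F (fst c \<inter> chart_proj c -` S) H \<and>
    (\<forall>y\<in>fst c \<inter> chart_proj c -` S. H (y, 1) = \<sigma> (chart_proj c y))"
proof -
  let ?U = "fst c \<inter> chart_proj c -` S"
  have fc: "foliated_chart n c" using at c by (simp add: foliated_atlas_def)
  then obtain a r \<psi> where a: "a \<in> euclidean_ball n a r" and op: "open (fst c)"
    and h: "homeomorphism (fst c) (euclidean_ball n a r \<times> chart_base c) (snd c) \<psi>"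
    by (rule foliated_chart_homeomorphism)
  let ?B = "euclidean_ball n a r"
  have pc: "continuous_on (fst c) (chart_proj c)" by (rule continuous_on_chart_proj[OF fc])
  have hc: "continuous_on (fst c) (snd c)" "continuous_on (?B \<times> chart_base c) \<psi>"
    and h\<psi>: "\<And>y. y \<in> fst c \<Longrightarrow> snd c y \<in> ?B \<times> chart_base c \<and> \<psi> (snd c y) = y"
    "\<And>z. z \<in> ?B \<times> chart_base c \<Longrightarrow> \<psi> z \<in> fst c \<and> snd c (\<psi> z) = z"
    using h by (auto simp: homeomorphism_def)
  have SS: "S \<subseteq> chart_base c" using S by (rule openin_imp_subset)
  have opU: "open ?U"
  proof -
    have "openin (top_of_set (fst c)) ?U"
      by (rule continuous_openin_preimage[OF pc _ S]) (auto simp: chart_base_def)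
    then show ?thesis using op by (rule openin_open_trans)
  qed
  \<comment> \<open>Time is clamped to the unit interval, where the segment stays in the ball.\<close>
  define e where "e = (\<lambda>z::'a \<times> real. segment_point (fst (snd c (fst z)))
    (fst (snd c (\<sigma> (chart_proj c (fst z))))) (max 0 (min 1 (snd z))))"
  define H where "H = (\<lambda>z. \<psi> (e z, chart_proj c (fst z)))"
  have eB: "e (y, t) \<in> ?B" if "y \<in> ?U" for y t
  proof -
    have "fst (snd c y) \<in> ?B" using h\<psi>(1)[of y] that by auto
    moreover have "fst (snd c (\<sigma> (chart_proj c y))) \<in> ?B"
      using h\<psi>(1)[of "\<sigma> (chart_proj c y)"] that \<sigma>(2) by auto
    ultimately show ?thesis unfolding e_def by (intro euclidean_ball_segment) auto
  qed
  have Hin: "H (y, t) \<in> fst c" "chart_proj c (H (y, t)) = chart_proj c y" if "y \<in> ?U" for y t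
    using h\<psi>(2)[of "(e (y, t), chart_proj c y)"] eB[OF that] that SS
    by (auto simp: H_def chart_proj_def)
  have cp: "continuous_on (?U \<times> UNIV) (\<lambda>z::'a \<times> real. chart_proj c (fst z))"
    by (rule continuous_on_compose2[OF pc]) (auto intro!: continuous_intros)
  have cs: "continuous_on (?U \<times> UNIV) (\<lambda>z::'a \<times> real. \<sigma> (chart_proj c (fst z)))"
    by (rule continuous_on_compose2[OF \<sigma>(1) cp]) auto
  have ce: "continuous_on (?U \<times> UNIV) e"
    unfolding e_def
  proof (intro continuous_on_segment_point continuous_on_fst)
    show "continuous_on (?U \<times> UNIV) (\<lambda>z::'a \<times> real. snd c (fst z))"
      by (rule continuous_on_compose2[OF hc(1)]) (auto intro!: continuous_intros)
    show "continuous_on (?U \<times> UNIV) (\<lambda>z::'a \<times> real. snd c (\<sigma> (chart_proj c (fst z))))"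
      by (rule continuous_on_compose2[OF hc(1) cs]) (use \<sigma>(2) in auto)
    show "continuous_on (?U \<times> UNIV) (\<lambda>z::'a \<times> real. max 0 (min 1 (snd z)))"
      by (intro continuous_intros)
  qed
  have "continuous_on (?U \<times> UNIV) H"
    unfolding H_def
    by (rule continuous_on_compose2[OF hc(2)])
      (use ce cp eB SS in \<open>auto intro!: continuous_on_Pair\<close>)
  moreover have "H (y, 0) = y" if "y \<in> ?U" for y
    using h\<psi>(1)[of y] that by (simp add: H_def e_def chart_proj_def)
  moreover have "connected_component_of (leaf_topology F) y (H (y, t))" if "y \<in> ?U" for y t
    by (rule connected_component_of_plaque[OF at c]) (use that Hin[OF that] in auto)
  moreover have H1: "H (y, 1) = \<sigma> (chart_proj c y)" if "y \<in> ?U" for y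
  proof -
    have "\<sigma> (chart_proj c y) \<in> fst c" "chart_proj c (\<sigma> (chart_proj c y)) = chart_proj c y"
      using that \<sigma>(2) by auto
    then have "(e (y, 1), chart_proj c y) = snd c (\<sigma> (chart_proj c y))"
      by (simp add: e_def chart_proj_def prod_eq_iff)
    then have "H (y, 1) = \<psi> (snd c (\<sigma> (chart_proj c y)))" by (simp add: H_def)
    then show ?thesis using h\<psi>(1) that \<sigma>(2) by simp
  qed
  moreover have "locally_constant_on_plaques F ?U (\<lambda>y. H (y, 1))"
    by (rule locally_constant_on_plaques_compose[OF locally_constant_on_plaques_chart_proj[OF at c]])
      (use H1 in auto)
  ultimately show ?thesis
    using opU unfolding leafwise_contraction_def by blast
qed

definition contracts_into ::
    "'a::topological_space chart set \<Rightarrow> 'a set \<Rightarrow> 'a set \<Rightarrow> bool" where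
  "contracts_into F U N \<longleftrightarrow> (\<exists>H. leafwise_contraction F U H \<and> (\<forall>y\<in>U. H (y, 1) \<in> N))"

lemma contracts_into_open: "contracts_into F U N \<Longrightarrow> open U"
  by (auto simp: contracts_into_def leafwise_contraction_def)

lemma contracts_into_restrict:
  assumes "contracts_into F U N" "open V" "V \<subseteq> U"
  shows "contracts_into F V N"
  using assms leafwise_contraction_restrict[OF _ assms(2,3)] unfolding contracts_into_def by blast

lemma contracts_into_disjoint_union:
  assumes "\<And>k. k \<in> I \<Longrightarrow> contracts_into F (U k) N" "disjoint_family_on U I"
  shows "contracts_into F (\<Union>k\<in>I. U k) N"
proof -
  have "\<forall>k\<in>I. \<exists>H. leafwise_contraction F (U k) H \<and> (\<forall>y\<in>U k. H (y, 1) \<in> N)"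
    using assms(1) by (simp add: contracts_into_def)
  then obtain H where H: "\<And>k. k \<in> I \<Longrightarrow> leafwise_contraction F (U k) (H k)"
    "\<And>k y. k \<in> I \<Longrightarrow> y \<in> U k \<Longrightarrow> H k (y, 1) \<in> N" by metis
  obtain K where K: "leafwise_contraction F (\<Union>k\<in>I. U k) K"
    "\<forall>k\<in>I. \<forall>x\<in>U k. \<forall>t. K (x, t) = H k (x, t)"
    using leafwise_contraction_disjoint_union[of I F U H] H(1) assms(2) by blast
  have "\<forall>y\<in>(\<Union>k\<in>I. U k). K (y, 1) \<in> N" using K(2) H(2) by auto
  then show ?thesis using K(1) unfolding contracts_into_def by blast
qed

lemma contracts_into_imp_categorical:
  assumes "foliated_atlas n F" "contracts_into F U N"
  shows "tangentially_categorical F U"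
  using assms leafwise_contraction_imp_tangential contracts_into_open
  unfolding tangentially_categorical_def contracts_into_def by blast

section \<open>Contractions in a minimal lamination\<close>

lemma foliated_atlas_covers:
  assumes "foliated_atlas n F"
  obtains c where "c \<in> F" "x \<in> fst c"
proof -
  have "x \<in> (\<Union>c\<in>F. fst c)" using assms by (simp add: foliated_atlas_def)
  then show thesis using that by blast
qed

text \<open>
  Near a point of the transversal the local inverse of the chart projection is a section with
  values in the transversal, and the plaques contract to it.
\<close>

lemma transversal_open_subset_contraction:
  assumes at: "foliated_atlas n F" and T: "transversal F T"
    and N: "openin (top_of_set T) N" and t: "t \<in> N"
  shows "\<exists>U. t \<in> U \<and> contracts_into F U N"
proof -
  obtain c where c: "c \<in> F" "t \<in> fst c" using at by (rule foliated_atlas_covers)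
  obtain O' where O': "open O'" "N = T \<inter> O'" using N by (auto simp: openin_open)
  have "local_homeomorphism (fst c \<inter> T) (chart_base c) (chart_proj c)"
    using T c(1) by (simp add: transversal_def)
  moreover have "t \<in> fst c \<inter> T" using c(2) t O' by auto
  ultimately obtain V W g where V: "t \<in> V" "openin (top_of_set (fst c \<inter> T)) V"
    "openin (top_of_set (chart_base c)) W" and g: "homeomorphism V W (chart_proj c) g"
    unfolding local_homeomorphism_def by blast
  have VT: "V \<subseteq> fst c \<inter> T" using V(2) by (rule openin_imp_subset)
  let ?S = "W \<inter> g -` O'"
  have gW: "continuous_on W g" "g ` W = V" "\<And>s. s \<in> W \<Longrightarrow> chart_proj c (g s) = s"
    and gt: "chart_proj c t \<in> W" "g (chart_proj c t) = t"
    using g V(1) by (auto simp: homeomorphism_def)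
  have "openin (top_of_set W) ?S" by (rule continuous_openin_preimage_gen[OF gW(1) O'(1)])
  then have S: "openin (top_of_set (chart_base c)) ?S" using V(3) by (rule openin_trans)
  have gS: "continuous_on ?S g" using gW(1) by (rule continuous_on_subset) auto
  have gs: "g s \<in> fst c \<and> chart_proj c (g s) = s" "g s \<in> N" if "s \<in> ?S" for s
    using that gW VT O'(2) by auto
  let ?U = "fst c \<inter> chart_proj c -` ?S"
  obtain H where H: "leafwise_contraction F ?U H"
    "\<forall>y\<in>?U. H (y, 1) = g (chart_proj c y)"
    using chart_contraction[OF at c(1) S gS gs(1)] by blast
  have "\<forall>y\<in>?U. H (y, 1) \<in> N" using H(2) gs(2) by simp
  then have "contracts_into F ?U N" using H(1) unfolding contracts_into_def by blast
  moreover have "t \<in> ?U" using c(2) gt t O'(2) by auto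
  ultimately show ?thesis by (intro exI[of _ ?U] conjI)
qed

text \<open>
  The slice of the chart through \<open>x\<close> is a section. Sliding the plaques to it takes \<open>y\<close> to
  \<open>x\<close>, and the points which arrive in \<open>U\<close> are then moved by the contraction of \<open>U\<close>.
\<close>

lemma plaque_contraction:
  assumes at: "foliated_atlas n F" and c: "c \<in> F" "x \<in> fst c" "y \<in> fst c"
    "chart_proj c y = chart_proj c x"
    and U: "x \<in> U" "contracts_into F U N"
  shows "\<exists>U. y \<in> U \<and> contracts_into F U N"
proof -
  obtain H where H: "leafwise_contraction F U H" "\<forall>y\<in>U. H (y, 1) \<in> N"
    using U(2) unfolding contracts_into_def by blast
  have "foliated_chart n c" using at c(1) by (simp add: foliated_atlas_def)
  then obtain a r \<psi> where
    h: "homeomorphism (fst c) (euclidean_ball n a r \<times> chart_base c) (snd c) \<psi>"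
    by (rule foliated_chart_homeomorphism)
  let ?B = "euclidean_ball n a r"
  define \<sigma> where "\<sigma> = (\<lambda>s. \<psi> (fst (snd c x), s))"
  have x: "fst (snd c x) \<in> ?B" "\<psi> (snd c x) = x"
    using h c(2) by (force simp: homeomorphism_def)+
  have \<psi>: "continuous_on (?B \<times> chart_base c) \<psi>"
    "\<And>z. z \<in> ?B \<times> chart_base c \<Longrightarrow> \<psi> z \<in> fst c \<and> snd c (\<psi> z) = z"
    using h by (auto simp: homeomorphism_def)
  have "continuous_on (chart_base c) \<sigma>"
    unfolding \<sigma>_def
    by (rule continuous_on_compose2[OF \<psi>(1)]) (use x in \<open>auto intro!: continuous_intros\<close>)
  moreover have "\<sigma> s \<in> fst c \<and> chart_proj c (\<sigma> s) = s" if "s \<in> chart_base c" for s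
    using \<psi>(2)[of "(fst (snd c x), s)"] that x(1) by (simp add: \<sigma>_def chart_proj_def)
  ultimately obtain G where G: "leafwise_contraction F (fst c \<inter> chart_proj c -` chart_base c) G"
    "\<forall>y\<in>fst c \<inter> chart_proj c -` chart_base c. G (y, 1) = \<sigma> (chart_proj c y)"
    using chart_contraction[OF at c(1), of "chart_base c" \<sigma>] by auto
  let ?V = "{z \<in> fst c \<inter> chart_proj c -` chart_base c. G (z, 1) \<in> U}"
  obtain K where K: "leafwise_contraction F ?V K"
    "\<forall>z. K (z, 1) = H (G (z, 1), 1)"
    using leafwise_contraction_concat[OF G(1) H(1)] by blast
  have y: "y \<in> fst c \<inter> chart_proj c -` chart_base c" using c(3) by (auto simp: chart_base_def)
  then have "G (y, 1) = x" using G(2) c(4) x(2) by (simp add: \<sigma>_def chart_proj_def)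
  then have "y \<in> ?V" using y U(1) by simp
  moreover have "\<forall>z\<in>?V. K (z, 1) \<in> N" using K(2) H(2) by simp
  ultimately show ?thesis using K(1) unfolding contracts_into_def by (intro exI[of _ ?V]) blast
qed

text \<open>
  The points that can be contracted into \<open>N\<close> form a nonempty open set, which contains with a
  point all plaques through it and hence its leaf. A dense leaf meets it, and so is contained in
  it.
\<close>

lemma minimal_contraction:
  assumes at: "foliated_atlas n F" and min: "minimal_lamination F" and T: "transversal F T"
    and N: "openin (top_of_set T) N" "N \<noteq> {}"
  shows "\<exists>U. x \<in> U \<and> contracts_into F U N"
proof -
  define G where "G = \<Union>{U. contracts_into F U N}"
  have "open G" unfolding G_def by (rule open_Union) (auto intro: contracts_into_open)
  have sat: "y \<in> G" if "P \<in> plaques F" "x \<in> P" "y \<in> P" "x \<in> G" for P x y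
  proof -
    from that(1) obtain c s where c: "c \<in> F" "P = {y \<in> fst c. chart_proj c y = s}"
      unfolding plaques_def by blast
    have c': "x \<in> fst c" "y \<in> fst c" "chart_proj c y = chart_proj c x"
      using that(2,3) c(2) by auto
    from that(4) obtain U where "x \<in> U" "contracts_into F U N" unfolding G_def by blast
    from plaque_contraction[OF at c(1) c' this] show ?thesis unfolding G_def by blast
  qed
  have const: "(\<lambda>x. x \<in> G) constant_on L" if "L \<in> leaves F" for L
  proof (rule constant_on_plaques_imp_leaves[OF _ that])
    fix P assume "P \<in> plaques F"
    then show "(\<lambda>x. x \<in> G) constant_on P" using sat unfolding constant_on_def by metis
  qed
  obtain t where "t \<in> N" using N(2) by blast
  then have "t \<in> G"
    using transversal_open_subset_contraction[OF at T N(1), of t] unfolding G_def by blast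
  let ?L = "connected_component_of_set (leaf_topology F) x"
  have L: "?L \<in> leaves F" by (rule leaf_of_point_in_leaves[OF at])
  then have "closure ?L = UNIV" using min by (simp add: minimal_lamination_def)
  then have "?L \<inter> G \<noteq> {}" using \<open>open G\<close> \<open>t \<in> G\<close> open_Int_closure_eq_empty[of G ?L] by auto
  moreover have "x \<in> ?L"
    by (simp add: connected_component_of_refl topspace_leaf_topology_atlas[OF at])
  ultimately have "x \<in> G" using const[OF L] unfolding constant_on_def by blast
  then show ?thesis unfolding G_def by blast
qed

section \<open>Measurability of the end of a contraction\<close>

lemma open_L2_ball: "open {x :: nat \<Rightarrow> real. L2_set (\<lambda>i. x i - a i) {..<n} < r}"
proof (rule open_Collect_less)
  have "continuous_on UNIV (\<lambda>x :: nat \<Rightarrow> real. x i)" for i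
    by (rule continuous_on_product_then_coordinatewise) (rule continuous_on_id)
  then show "continuous_on UNIV (\<lambda>x :: nat \<Rightarrow> real. L2_set (\<lambda>i. x i - a i) {..<n})"
    unfolding L2_set_def by (intro continuous_intros)
qed (rule continuous_on_const)

lemma Euclidean_space_eq_top_of_set:
  "Euclidean_space n = top_of_set (topspace (Euclidean_space n))"
  by (simp add: Euclidean_space_def euclidean_product_topology)

lemma locally_compact_openin_Euclidean_space:
  assumes "openin (Euclidean_space n) S"
  shows "locally_compact_space (top_of_set S)"
proof -
  have "locally_compact_space (subtopology (Euclidean_space n) S)"
    using assms by (intro locally_compact_space_open_subset disjI1 Hausdorff_Euclidean_space
        locally_compact_Euclidean_space)
  moreover have "subtopology (Euclidean_space n) S = top_of_set S"
    using openin_subset[OF assms] 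
    by (subst Euclidean_space_eq_top_of_set) (simp add: subtopology_subtopology Int_absorb1)
  ultimately show ?thesis by simp
qed

lemma openin_euclidean_ball: "openin (Euclidean_space n) (euclidean_ball n a r)"
proof -
  have "euclidean_ball n a r = topspace (Euclidean_space n) \<inter>
      {x. L2_set (\<lambda>i. x i - a i) {..<n} < r}"
    by (auto simp: euclidean_ball_def)
  then show ?thesis
    by (subst Euclidean_space_eq_top_of_set) (simp add: openin_open_Int open_L2_ball)
qed

text \<open>
  Open subsets of Euclidean spaces are locally compact, and so is their product, which models a
  foliated chart of a manifold.
\<close>

lemma foliated_manifold_compact_neighbourhood:
  fixes F :: "'a::metric_space chart set" and x :: 'a
  assumes F: "foliated_manifold n q F" and U: "open U" "x \<in> U"
  obtains O' K where "open O'" "compact K" "x \<in> O'" "O' \<subseteq> K" "K \<subseteq> U"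
proof -
  obtain c where c: "c \<in> F" "x \<in> fst c" "openin (Euclidean_space q) (chart_base c)"
    using F unfolding foliated_manifold_def by blast
  have "foliated_chart n c"
    using F c(1) by (simp add: foliated_manifold_def lamination_def foliated_atlas_def)
  then obtain a r \<psi> where op: "open (fst c)"
    and h: "homeomorphism (fst c) (euclidean_ball n a r \<times> chart_base c) (snd c) \<psi>"
    by (rule foliated_chart_homeomorphism)
  let ?Z = "euclidean_ball n a r \<times> chart_base c"
  have "locally_compact_space (prod_topology (top_of_set (euclidean_ball n a r)) (top_of_set (chart_base c)))"
    unfolding locally_compact_space_prod_topology
    using locally_compact_openin_Euclidean_space[OF c(3)]
      locally_compact_openin_Euclidean_space[OF openin_euclidean_ball] by blast
  then have "locally_compact_space (top_of_set ?Z)" by simp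
  moreover have "top_of_set (fst c) homeomorphic_space top_of_set ?Z"
    using h unfolding homeomorphic_space_def homeomorphic_maps_def homeomorphism_def
    by (intro exI[of _ "snd c"] exI[of _ \<psi>]) auto
  ultimately have "locally_compact_space (top_of_set (fst c))"
    using homeomorphic_locally_compact_space by blast
  moreover have "openin (top_of_set (fst c)) (fst c \<inter> U)" using U(1) by (rule openin_open_Int)
  ultimately have "locally_compact_space (subtopology (top_of_set (fst c)) (fst c \<inter> U))"
    by (rule locally_compact_space_open_subset[OF disjI1[OF Hausdorff_space_subtopology[OF Hausdorff_space_euclidean]]])
  then have "locally_compact_space (top_of_set (fst c \<inter> U))"
    by (simp add: subtopology_subtopology Int_absorb1)
  moreover have "x \<in> topspace (top_of_set (fst c \<inter> U))" using c(2) U(2) by simp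
  ultimately obtain O' K where "openin (top_of_set (fst c \<inter> U)) O'"
    "compactin (top_of_set (fst c \<inter> U)) K" "x \<in> O'" "O' \<subseteq> K"
    unfolding locally_compact_space_def by blast
  moreover have "open (fst c \<inter> U)" using op U(1) by blast
  ultimately show thesis using that[of O' K]
    by (auto simp: compactin_subtopology dest: openin_open_trans)
qed

text \<open>
  Continuous images of open sets are in general only analytic. In a manifold an open set is a
  countable union of compact sets, and so is its image.
\<close>

lemma borel_image_of_open:
  fixes F :: "'a::{second_countable_topology,metric_space} chart set" and f :: "'a \<Rightarrow> 'b::t2_space"
  assumes F: "foliated_manifold n q F" and U: "open U" and f: "continuous_on U f"
  shows "f ` U \<in> sets borel"
proof -
  let ?\<F> = "{O'. open O' \<and> (\<exists>K. compact K \<and> O' \<subseteq> K \<and> K \<subseteq> U)}"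
  have U_eq: "U = \<Union>?\<F>"
  proof
    show "U \<subseteq> \<Union>?\<F>"
    proof
      fix x assume "x \<in> U"
      then obtain O' K where "open O'" "compact K" "x \<in> O'" "O' \<subseteq> K" "K \<subseteq> U"
        by (rule foliated_manifold_compact_neighbourhood[OF F U])
      then show "x \<in> \<Union>?\<F>" by blast
    qed
  qed blast
  obtain \<G> where \<G>: "\<G> \<subseteq> ?\<F>" "countable \<G>" "\<Union>\<G> = \<Union>?\<F>"
    by (rule Lindelof[of ?\<F>]) auto
  have G: "\<G> \<subseteq> ?\<F>" "countable \<G>" "\<Union>\<G> = U" using \<G> U_eq by simp_all
  have "\<forall>O'\<in>\<G>. \<exists>K. compact K \<and> O' \<subseteq> K \<and> K \<subseteq> U" using G(1) by blast
  then obtain k where k: "\<And>O'. O' \<in> \<G> \<Longrightarrow> compact (k O') \<and> O' \<subseteq> k O' \<and> k O' \<subseteq> U" by metis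
  have "U = (\<Union>O'\<in>\<G>. k O')" using G(3) k by blast
  then have "f ` U = (\<Union>O'\<in>\<G>. f ` k O')" by blast
  moreover have "f ` k O' \<in> sets borel" if "O' \<in> \<G>" for O'
    using k[OF that] continuous_on_subset[OF f]
    by (intro borel_closed compact_imp_closed compact_continuous_image) auto
  ultimately show ?thesis using G(2) by (simp only:) (rule sets.countable_UN', auto)
qed

section \<open>The measure of the end of a contraction\<close>

lemma sets_Int_space:
  assumes "sets \<Lambda> = sets (restrict_space borel (space \<Lambda>))" "S \<in> sets borel"
  shows "space \<Lambda> \<inter> S \<in> sets \<Lambda>"
  using assms(2) by (subst assms(1)) (simp only: sets_restrict_space imageI)

lemma sets_openin_space:
  assumes "sets \<Lambda> = sets (restrict_space borel (space \<Lambda>))" "openin (top_of_set (space \<Lambda>)) V"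
  shows "V \<in> sets \<Lambda>"
proof -
  obtain O' where "open O'" "V = space \<Lambda> \<inter> O'" using assms(2) unfolding openin_open by blast
  then show ?thesis using sets_Int_space[OF assms(1), of O'] by simp
qed

text \<open>
  A Borel subset of the transversal, left in place, is one of the decompositions over which the
  infimum is taken.
\<close>

lemma transverse_ext_le_emeasure:
  fixes F :: "'a::topological_space chart set"
  assumes at: "foliated_atlas n F" and B: "B \<in> sets borel" "B \<subseteq> space \<Lambda>"
  shows "transverse_ext F \<Lambda> B \<le> emeasure \<Lambda> B"
proof -
  define P where "P = (\<lambda>i::nat. if i = 0 then B else {})"
  have iso: "leafwise_measurable_iso F C C (\<lambda>x. x)" if "C \<in> sets borel" for C
  proof -
    have inv: "the_inv_into C (\<lambda>x. x) x = x" if "x \<in> C" for x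
      using the_inv_into_f_f[of "\<lambda>x. x" C x] that by simp
    have "the_inv_into C (\<lambda>x. x) \<in> measurable (restrict_space borel C) (restrict_space borel C)
      \<longleftrightarrow> (\<lambda>x. x) \<in> measurable (restrict_space borel C) (restrict_space borel C)"
      by (rule measurable_cong) (auto simp: space_restrict_space inv)
    moreover have "\<exists>L\<in>leaves F. x \<in> L \<and> x \<in> L" for x
      by (intro bexI[OF _ leaf_of_point_in_leaves[OF at, of x]])
        (simp add: connected_component_of_refl topspace_leaf_topology_atlas[OF at])
    ultimately show ?thesis using that
      by (simp add: leafwise_measurable_iso_def bij_betw_def)
  qed
  have "transverse_ext F \<Lambda> B \<le> (\<Sum>i. emeasure \<Lambda> ((\<lambda>x. x) ` P i))"
    unfolding transverse_ext_def
  proof (rule INF_lower2[of "(P, \<lambda>_ x. x)"])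
    have "disjoint_family P" by (auto simp: disjoint_family_on_def P_def)
    moreover have "(\<Union>i. P i) = B" by (auto simp: P_def split: if_splits)
    moreover have "P i \<subseteq> space \<Lambda>" "P i \<in> sets borel" for i using B by (auto simp: P_def)
    ultimately show "(P, \<lambda>_ x. x) \<in> {(P, f). disjoint_family P \<and> (\<Union>i. P i) = B \<and>
        (\<forall>i. f i ` P i \<subseteq> space \<Lambda> \<and> leafwise_measurable_iso F (P i) (f i ` P i) (f i))}"
      using iso by simp
  qed simp
  also have "\<dots> = (\<Sum>i. emeasure \<Lambda> (P i))" by simp
  also have "\<dots> = (\<Sum>i\<in>{0}. emeasure \<Lambda> (P i))" by (rule suminf_finite) (auto simp: P_def)
  finally show ?thesis by (simp add: P_def)
qed

lemma tau_le_emeasure: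
  fixes F :: "'a::polish_space chart set"
  assumes F: "foliated_manifold n q F" and sets: "sets \<Lambda> = sets (restrict_space borel (space \<Lambda>))"
    and N: "openin (top_of_set (space \<Lambda>)) N" and U: "contracts_into F U N"
  shows "tau F \<Lambda> U \<le> emeasure \<Lambda> N"
proof -
  have at: "foliated_atlas n F" using F by (simp add: foliated_manifold_def lamination_def)
  obtain H where H: "leafwise_contraction F U H" "\<forall>y\<in>U. H (y, 1) \<in> N"
    using U by (auto simp: contracts_into_def)
  have cH: "continuous_on (U \<times> UNIV) H" and "open U"
    using H(1) by (auto simp: leafwise_contraction_def)
  have im: "H ` (U \<times> {1}) = (\<lambda>y. H (y, 1)) ` U" by auto
  have "continuous_on U (\<lambda>y. H (y, 1))"
    by (rule continuous_on_compose2[OF cH]) (auto intro!: continuous_intros)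
  then have B: "H ` (U \<times> {1}) \<in> sets borel"
    unfolding im by (rule borel_image_of_open[OF F \<open>open U\<close>])
  have BN: "H ` (U \<times> {1}) \<subseteq> N" using H(2) by auto
  have NT: "N \<subseteq> space \<Lambda>" using N by (rule openin_imp_subset)
  have "tau F \<Lambda> U \<le> transverse_ext F \<Lambda> (H ` (U \<times> {1}))"
    unfolding tau_def
    by (rule INF_lower) (use leafwise_contraction_imp_tangential[OF at H(1)] in simp)
  also have "\<dots> \<le> emeasure \<Lambda> (H ` (U \<times> {1}))"
    by (rule transverse_ext_le_emeasure[OF at B]) (use BN NT in blast)
  also have "\<dots> \<le> emeasure \<Lambda> N"
    using BN by (rule emeasure_mono) (rule sets_openin_space[OF sets N])
  finally show ?thesis .
qed

section \<open>Disjoint contractions covering almost all of the transversal\<close>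

lemma emeasure_small_open_superset:
  assumes "regular_measure \<Lambda>" "B \<in> sets \<Lambda>" "emeasure \<Lambda> B = 0" "(e::real) > 0"
  obtains V where "openin (top_of_set (space \<Lambda>)) V" "B \<subseteq> V" "emeasure \<Lambda> V < ennreal e"
proof -
  have "(INF V\<in>{V. openin (top_of_set (space \<Lambda>)) V \<and> B \<subseteq> V}. emeasure \<Lambda> V) < ennreal e"
    using assms by (metis ennreal_less_zero_iff regular_measure_def)
  then show thesis using that by (auto simp: INF_less_iff)
qed

text \<open>
  The image of the finite measure on the ball under the distance to \<open>t\<close> is a finite measure on
  the line, which has only countably many atoms.
\<close>

lemma exists_null_sphere:
  fixes \<Lambda> :: "'a::metric_space measure"
  assumes sets: "sets \<Lambda> = sets (restrict_space borel (space \<Lambda>))"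
    and fin: "emeasure \<Lambda> (space \<Lambda> \<inter> ball t \<rho>) < \<infinity>" and "\<rho> > 0"
  obtains r where "0 < r" "r < \<rho>" "emeasure \<Lambda> (space \<Lambda> \<inter> sphere t r) = 0"
proof -
  let ?A = "space \<Lambda> \<inter> ball t \<rho>"
  have A: "?A \<in> sets \<Lambda>" by (rule sets_Int_space[OF sets]) simp
  define M where "M = restrict_space \<Lambda> ?A"
  have spM: "space M = ?A" by (auto simp: M_def space_restrict_space)
  have "finite_measure M"
    by (rule finite_measureI) (use A fin in \<open>simp add: M_def emeasure_restrict_space space_restrict_space\<close>)
  have "(\<lambda>x. dist t x) \<in> borel_measurable \<Lambda>"
    unfolding measurable_cong_sets[OF sets refl]
    by (intro measurable_restrict_space1 borel_measurable_continuous_onI continuous_intros)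
  then have dM: "(\<lambda>x. dist t x) \<in> borel_measurable M"
    unfolding M_def by (rule measurable_restrict_space1)
  let ?N = "distr M borel (\<lambda>x. dist t x)"
  have "finite_measure ?N" using \<open>finite_measure M\<close> dM by (rule finite_measure.finite_measure_distr)
  then have "countable {x. measure ?N {x} \<noteq> 0}" by (rule finite_measure.countable_support)
  moreover have "uncountable {0<..<\<rho>}" using \<open>\<rho> > 0\<close> by (simp add: uncountable_open_interval)
  ultimately have "\<not> {0<..<\<rho>} \<subseteq> {x. measure ?N {x} \<noteq> 0}" using countable_subset by blast
  then obtain r where r: "0 < r" "r < \<rho>" "measure ?N {r} = 0" by auto
  have "emeasure ?N {r} = 0"
    using r(3) \<open>finite_measure ?N\<close> by (simp add: finite_measure.emeasure_eq_measure)
  moreover have "emeasure ?N {r} = emeasure M ((\<lambda>x. dist t x) -` {r} \<inter> space M)"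
    by (rule emeasure_distr[OF dM]) simp
  moreover have "(\<lambda>x. dist t x) -` {r} \<inter> space M = space \<Lambda> \<inter> sphere t r"
    using r(2) by (auto simp: spM)
  moreover have "emeasure M (space \<Lambda> \<inter> sphere t r) = emeasure \<Lambda> (space \<Lambda> \<inter> sphere t r)"
    unfolding M_def by (rule emeasure_restrict_space) (use A r(2) in auto)
  ultimately show thesis using that r(1,2) by simp
qed

text \<open>
  Cover the transversal by countably many balls which contract into \<open>N\<close> and whose spheres are
  null, and remove from each ball the earlier closed balls. The remainders are disjoint and open,
  so their union still contracts into \<open>N\<close>, and they miss only points on the spheres.
\<close>

lemma contracts_into_almost_everywhere:
  fixes F :: "'a::polish_space chart set"
  assumes sets: "sets \<Lambda> = sets (restrict_space borel (space \<Lambda>))"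
    and reg: "regular_measure \<Lambda>" and na: "without_atoms \<Lambda>" and ne: "space \<Lambda> \<noteq> {}"
    and N: "\<And>x. \<exists>U. x \<in> U \<and> contracts_into F U N"
  obtains D where "contracts_into F D N" "space \<Lambda> - D \<in> sets \<Lambda>" "emeasure \<Lambda> (space \<Lambda> - D) = 0"
proof -
  let ?T = "space \<Lambda>"
  have "\<exists>r>0. emeasure \<Lambda> (?T \<inter> sphere t r) = 0 \<and> contracts_into F (ball t r) N" if t: "t \<in> ?T" for t
  proof -
    obtain U where U: "t \<in> U" "contracts_into F U N" using N by blast
    have "{t} \<in> sets \<Lambda>" using sets_Int_space[OF sets, of "{t}"] t by simp
    moreover have "emeasure \<Lambda> {t} = 0" using na t by (simp add: without_atoms_def)
    ultimately obtain V where V: "openin (top_of_set ?T) V" "{t} \<subseteq> V" "emeasure \<Lambda> V < ennreal 1"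
      using emeasure_small_open_superset[OF reg, of "{t}" 1] by auto
    obtain O' where O': "open O'" "V = ?T \<inter> O'" using V(1) by (auto simp: openin_open)
    have "open (U \<inter> O')" "t \<in> U \<inter> O'" using U contracts_into_open O' V(2) by auto
    then obtain \<rho> where \<rho>: "\<rho> > 0" "ball t \<rho> \<subseteq> U \<inter> O'" using open_contains_ball by blast
    have "emeasure \<Lambda> (?T \<inter> ball t \<rho>) \<le> emeasure \<Lambda> V"
      by (rule emeasure_mono) (use \<rho>(2) O'(2) sets_openin_space[OF sets V(1)] in auto)
    also have "\<dots> < ennreal 1" by (rule V(3))
    also have "\<dots> < \<infinity>" by simp
    finally obtain r where r: "0 < r" "r < \<rho>" "emeasure \<Lambda> (?T \<inter> sphere t r) = 0"
      using exists_null_sphere[OF sets _ \<rho>(1)] by blast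
    have "ball t r \<subseteq> U" using r(2) \<rho>(2) subset_ball[of r \<rho> t] by auto
    then have "contracts_into F (ball t r) N" by (rule contracts_into_restrict[OF U(2) open_ball])
    then show ?thesis using r by blast
  qed
  then obtain r where r: "\<And>t. t \<in> ?T \<Longrightarrow> r t > 0"
    "\<And>t. t \<in> ?T \<Longrightarrow> emeasure \<Lambda> (?T \<inter> sphere t (r t)) = 0"
    "\<And>t. t \<in> ?T \<Longrightarrow> contracts_into F (ball t (r t)) N"
    by metis
  obtain \<G> where \<G>: "\<G> \<subseteq> (\<lambda>t. ball t (r t)) ` ?T" "countable \<G>"
      "\<Union>\<G> = \<Union>((\<lambda>t. ball t (r t)) ` ?T)"
    by (rule Lindelof[of "(\<lambda>t. ball t (r t)) ` ?T"]) auto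
  obtain C where C: "C \<subseteq> ?T" "countable C" "\<G> = (\<lambda>t. ball t (r t)) ` C"
    using countable_subset_image[of \<G> "\<lambda>t. ball t (r t)" ?T] \<G>(1,2) by blast
  have cov: "?T \<subseteq> (\<Union>t\<in>C. ball t (r t))"
  proof
    fix t assume "t \<in> ?T"
    then have "t \<in> \<Union>((\<lambda>t. ball t (r t)) ` ?T)" using r(1) by force
    then show "t \<in> (\<Union>t\<in>C. ball t (r t))" using \<G>(3) C(3) by simp
  qed
  then have "C \<noteq> {}" using ne by auto
  define t where "t = from_nat_into C"
  have tT: "t k \<in> ?T" for k using C(1) from_nat_into[OF \<open>C \<noteq> {}\<close>] by (auto simp: t_def)
  have rangeC: "range t = C" using \<open>C \<noteq> {}\<close> C(2) by (simp add: t_def)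
  define D where "D k = ball (t k) (r (t k)) - (\<Union>j<k. cball (t j) (r (t j)))" for k
  have "disjoint_family D"
    unfolding disjoint_family_on_def
  proof (intro ballI impI)
    fix i j :: nat assume "i \<noteq> j"
    then consider "i < j" | "j < i" by linarith
    then show "D i \<inter> D j = {}" by cases (auto simp: D_def)
  qed
  moreover have "contracts_into F (D k) N" for k
  proof (rule contracts_into_restrict[OF r(3)[OF tT]])
    show "open (D k)" unfolding D_def by (intro open_Diff closed_UN) auto
    show "D k \<subseteq> ball (t k) (r (t k))" by (auto simp: D_def)
  qed
  ultimately have D: "contracts_into F (\<Union>k. D k) N" by (rule contracts_into_disjoint_union[rotated])
  have meas: "?T \<inter> S \<in> sets \<Lambda>" if "S \<in> sets borel" for S
    using that by (rule sets_Int_space[OF sets])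
  have "open (\<Union>k. D k)" using D by (rule contracts_into_open)
  then have "?T \<inter> - (\<Union>k. D k) \<in> sets \<Lambda>" by (intro meas borel_closed closed_Compl)
  moreover have "?T \<inter> - (\<Union>k. D k) = ?T - (\<Union>k. D k)" by blast
  ultimately have m: "?T - (\<Union>k. D k) \<in> sets \<Lambda>" by simp
  have sph: "?T \<inter> sphere (t j) (r (t j)) \<in> sets \<Lambda>" for j
    unfolding cball_diff_eq_sphere[symmetric]
    by (intro meas borel_closed closed_Diff closed_cball open_ball)
  have "?T - (\<Union>k. D k) \<subseteq> (\<Union>j. ?T \<inter> sphere (t j) (r (t j)))"
  proof
    fix x assume x: "x \<in> ?T - (\<Union>k. D k)"
    then have "x \<in> (\<Union>u\<in>range t. ball u (r u))" unfolding rangeC using cov by blast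
    then have ex: "\<exists>k. x \<in> ball (t k) (r (t k))" by blast
    define k where "k = (LEAST k. x \<in> ball (t k) (r (t k)))"
    have "x \<in> ball (t k) (r (t k))" using ex unfolding k_def by (rule LeastI_ex)
    then obtain j where j: "j < k" "x \<in> cball (t j) (r (t j))" using x by (auto simp: D_def)
    have "x \<notin> ball (t j) (r (t j))" using j(1) not_less_Least unfolding k_def by blast
    then show "x \<in> (\<Union>j. ?T \<inter> sphere (t j) (r (t j)))" using j(2) x by (intro UN_I[of j]) auto
  qed
  moreover have "emeasure \<Lambda> (\<Union>j. ?T \<inter> sphere (t j) (r (t j))) = 0"
    by (rule emeasure_UN_eq_0) (use r(2)[OF tT] sph in auto)
  moreover have "(\<Union>j. ?T \<inter> sphere (t j) (r (t j))) \<in> sets \<Lambda>"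
    by (intro sets.countable_UN) (use sph in auto)
  ultimately have "emeasure \<Lambda> (?T - (\<Union>k. D k)) = 0" by (metis emeasure_eq_0)
  then show thesis using that D m by blast
qed

section \<open>Vanishing of the category\<close>

text \<open>
  The sum runs over the set of values of \<open>U\<close>, so that repetitions among the \<open>U m\<close> are counted
  once.
\<close>

lemma infsum_range_le_geometric:
  fixes \<tau> :: "'b \<Rightarrow> ennreal" and U :: "nat \<Rightarrow> 'b"
  assumes "\<And>m. \<tau> (U m) \<le> ennreal (e * (1/2) ^ Suc m)" "e \<ge> 0"
  shows "(\<Sum>\<^sub>\<infinity>V\<in>range U. \<tau> V) \<le> ennreal e"
proof -
  have "sum \<tau> A \<le> ennreal e" if A: "finite A" "A \<subseteq> range U" for A
  proof -
    obtain J where J: "finite J" "A = U ` J" using finite_subset_image[OF A] by blast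
    have s: "(\<lambda>m. e * (1/2) ^ Suc m) sums (e * 1)"
      by (intro sums_mult power_half_series)
    have "sum \<tau> A \<le> (\<Sum>m\<in>J. \<tau> (U m))"
      unfolding J(2) using sum_image_le[OF J(1), of \<tau> U] by simp
    also have "\<dots> \<le> (\<Sum>m\<in>J. ennreal (e * (1/2) ^ Suc m))" by (intro sum_mono assms)
    also have "\<dots> = ennreal (\<Sum>m\<in>J. e * (1/2) ^ Suc m)"
      by (rule sum_ennreal) (use assms(2) in simp)
    also have "\<dots> \<le> ennreal e"
    proof (rule ennreal_leI)
      have "(\<Sum>m\<in>J. e * (1/2) ^ Suc m) \<le> (\<Sum>m. e * (1/2) ^ Suc m)"
        by (rule sum_le_suminf) (use s J(1) assms(2) in \<open>auto simp: sums_iff\<close>)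
      then show "(\<Sum>m\<in>J. e * (1/2) ^ Suc m) \<le> e" using s by (simp add: sums_iff)
    qed
    finally show ?thesis .
  qed
  then show ?thesis by (subst nonneg_infsum_complete) (auto intro!: SUP_least)
qed

text \<open>
  Follow the contraction \<open>H\<close> of \<open>W\<close> into the transversal. The points arriving in the set \<open>D\<close>
  of full measure are moved on into a small neighbourhood \<open>N\<close> of some point; the others arrive in
  a small neighbourhood \<open>V\<close> of the null set outside \<open>D\<close> and stay there.
\<close>

lemma contraction_small_pieces:
  fixes F :: "'a::polish_space chart set"
  assumes F: "foliated_manifold n q F" and min: "minimal_lamination F"
    and \<Lambda>: "transverse_invariant_measure F \<Lambda>" "regular_measure \<Lambda>" "without_atoms \<Lambda>"
    and ne: "space \<Lambda> \<noteq> {}"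
    and W: "contracts_into F W (space \<Lambda>)" and e: "e > (0::real)"
  obtains A B where "W = A \<union> B"
    "tangentially_categorical F A" "tau F \<Lambda> A \<le> ennreal e"
    "tangentially_categorical F B" "tau F \<Lambda> B \<le> ennreal e"
proof -
  let ?T = "space \<Lambda>"
  have at: "foliated_atlas n F" using F by (simp add: foliated_manifold_def lamination_def)
  have sets: "sets \<Lambda> = sets (restrict_space borel ?T)" and T: "transversal F ?T"
    using \<Lambda>(1) by (auto simp: transverse_invariant_measure_def complete_transversal_def)
  have small: "\<exists>V. openin (top_of_set ?T) V \<and> B \<subseteq> V \<and> emeasure \<Lambda> V < ennreal e"
    if "B \<in> sets \<Lambda>" "emeasure \<Lambda> B = 0" for B
    using emeasure_small_open_superset[OF \<Lambda>(2) that e] by metis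
  \<comment> \<open>Points are null, so any of them has neighbourhoods of small measure to serve as target.\<close>
  obtain t where t: "t \<in> ?T" using ne by blast
  have "{t} \<in> sets \<Lambda>" using sets_Int_space[OF sets, of "{t}"] t by simp
  moreover have "emeasure \<Lambda> {t} = 0" using \<Lambda>(3) t by (simp add: without_atoms_def)
  ultimately obtain N where N: "openin (top_of_set ?T) N" "{t} \<subseteq> N" "emeasure \<Lambda> N < ennreal e"
    using small by blast
  have "\<exists>U. x \<in> U \<and> contracts_into F U N" for x
    by (rule minimal_contraction[OF at min T N(1)]) (use N(2) in auto)
  then obtain D where D: "contracts_into F D N" "?T - D \<in> sets \<Lambda>" "emeasure \<Lambda> (?T - D) = 0"
    by (rule contracts_into_almost_everywhere[OF sets \<Lambda>(2,3) ne])
  obtain V where V: "openin (top_of_set ?T) V" "?T - D \<subseteq> V" "emeasure \<Lambda> V < ennreal e"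
    using small[OF D(2,3)] by blast
  obtain O' where O': "open O'" "V = ?T \<inter> O'" using V(1) by (auto simp: openin_open)
  obtain H where H: "leafwise_contraction F W H" "\<forall>y\<in>W. H (y, 1) \<in> ?T"
    using W by (auto simp: contracts_into_def)
  obtain G where G: "leafwise_contraction F D G" "\<forall>y\<in>D. G (y, 1) \<in> N"
    using D(1) by (auto simp: contracts_into_def)
  let ?A = "{x \<in> W. H (x, 1) \<in> D}" and ?B = "{x \<in> W. H (x, 1) \<in> O'}"
  obtain K where "leafwise_contraction F ?A K" "\<forall>x. K (x, 1) = G (H (x, 1), 1)"
    using leafwise_contraction_concat[OF H(1) G(1)] by blast
  then have A: "contracts_into F ?A N" using G(2) by (auto simp: contracts_into_def)
  have cH: "continuous_on (W \<times> UNIV) H" and opW: "open W"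
    using H(1) by (auto simp: leafwise_contraction_def)
  have "continuous_on W (\<lambda>x. H (x, 1))"
    by (rule continuous_on_compose2[OF cH]) (auto intro!: continuous_intros)
  then have "open (W \<inter> (\<lambda>x. H (x, 1)) -` O')" using opW O'(1) by (rule continuous_open_preimage)
  moreover have "W \<inter> (\<lambda>x. H (x, 1)) -` O' = ?B" by auto
  ultimately have "open ?B" by simp
  then have "leafwise_contraction F ?B H" by (rule leafwise_contraction_restrict[OF H(1)]) auto
  then have B: "contracts_into F ?B V" using H(2) O'(2) by (auto simp: contracts_into_def)
  show thesis
  proof
    show "W = ?A \<union> ?B"
    proof (intro equalityI subsetI)
      fix x assume x: "x \<in> W"
      then have "H (x, 1) \<in> ?T" using H(2) by blast
      then show "x \<in> ?A \<union> ?B" using x V(2) O'(2) by blast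
    qed blast
    show "tau F \<Lambda> ?A \<le> ennreal e"
      using tau_le_emeasure[OF F sets N(1) A] N(3) by simp
    show "tau F \<Lambda> ?B \<le> ennreal e"
      using tau_le_emeasure[OF F sets V(1) B] V(3) by simp
  qed (use A B contracts_into_imp_categorical[OF at] in blast)+
qed

theorem corollary3p7:
  fixes F :: "'a::polish_space chart set" and \<Lambda> :: "'a measure" and n q :: nat
  assumes "foliated_manifold n q F"
    and "minimal_lamination F"
    and "transverse_invariant_measure F \<Lambda>"
    and "regular_measure \<Lambda>"
    and "without_atoms \<Lambda>"
  shows "Cat F \<Lambda> = 0"
proof -
  let ?T = "space \<Lambda>"
  have at: "foliated_atlas n F" using assms(1) by (simp add: foliated_manifold_def lamination_def)
  have T: "transversal F ?T" and meets: "\<And>L. L \<in> leaves F \<Longrightarrow> ?T \<inter> L \<noteq> {}"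
    using assms(3) by (auto simp: transverse_invariant_measure_def complete_transversal_def)
  have ne: "?T \<noteq> {}" using meets[OF leaf_of_point_in_leaves[OF at, of undefined]] by auto
  have ex: "\<exists>U. x \<in> U \<and> contracts_into F U ?T" for x
    by (rule minimal_contraction[OF at assms(2) T]) (use ne in auto)
  obtain \<W> where \<W>: "\<W> \<subseteq> {U. contracts_into F U ?T}" "countable \<W>"
    "\<Union>\<W> = \<Union>{U. contracts_into F U ?T}"
    by (rule Lindelof[of "{U. contracts_into F U ?T}"]) (auto intro: contracts_into_open)
  have cov: "\<Union>\<W> = UNIV" unfolding \<W>(3) using ex by blast
  then have "\<W> \<noteq> {}" by auto
  \<comment> \<open>Enumerations of a nonempty countable set may repeat members, so finite covers are included.\<close>
  define W where "W = from_nat_into \<W>"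
  have rangeW: "range W = \<W>" unfolding W_def by (rule range_from_nat_into[OF \<open>\<W> \<noteq> {}\<close> \<W>(2)])
  have W: "contracts_into F (W k) ?T" for k using rangeW \<W>(1) by auto
  have "Cat F \<Lambda> \<le> 0 + ennreal e" if e: "e > 0" for e :: real
  proof -
    have "\<exists>A B. W k = A \<union> B \<and>
      (tangentially_categorical F A \<and> tau F \<Lambda> A \<le> ennreal (e * (1/2) ^ (2 * k + 2))) \<and>
      tangentially_categorical F B \<and> tau F \<Lambda> B \<le> ennreal (e * (1/2) ^ (2 * k + 2))" for k
    proof -
      have "e * (1/2) ^ (2 * k + 2) > 0" using e by simp
      then show ?thesis
        by (rule contraction_small_pieces[OF assms ne W[of k]]) blast
    qed
    then obtain A B where AB: "\<And>k. W k = A k \<union> B k"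
      "\<And>k. tangentially_categorical F (A k)" "\<And>k. tangentially_categorical F (B k)"
      "\<And>k. tau F \<Lambda> (A k) \<le> ennreal (e * (1/2) ^ (2 * k + 2))"
      "\<And>k. tau F \<Lambda> (B k) \<le> ennreal (e * (1/2) ^ (2 * k + 2))"
      by metis
    \<comment> \<open>Interleaving the two families: \<open>U m\<close> has a bound \<open>e / 2 ^ (2k + 2)\<close> with \<open>2k + 1 \<ge> m\<close>,
      so it is at most \<open>e / 2 ^ (m + 1)\<close>.\<close>
    define U where "U m = (if even m then A (m div 2) else B (m div 2))" for m
    have "tau F \<Lambda> (U m) \<le> ennreal (e * (1/2) ^ Suc m)" for m
    proof -
      have "tau F \<Lambda> (U m) \<le> ennreal (e * (1/2) ^ (2 * (m div 2) + 2))"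
        by (cases "even m") (simp_all only: U_def if_True if_False AB(4,5))
      also have "\<dots> \<le> ennreal (e * (1/2) ^ Suc m)"
        by (intro ennreal_leI mult_left_mono power_decreasing) (use e in auto)
      finally show ?thesis .
    qed
    then have le: "(\<Sum>\<^sub>\<infinity>V\<in>range U. tau F \<Lambda> V) \<le> ennreal e"
      by (rule infsum_range_le_geometric) (use e in simp)
    have "U (2 * k) = A k" "U (2 * k + 1) = B k" for k by (simp_all add: U_def)
    then have "W k \<subseteq> \<Union>(range U)" for k unfolding AB(1) by (metis Sup_upper Un_least rangeI)
    then have "\<Union>(range U) = UNIV" using cov rangeW by blast
    moreover have "\<forall>V\<in>range U. tangentially_categorical F V" using AB(2,3) by (auto simp: U_def)
    ultimately have "Cat F \<Lambda> \<le> (\<Sum>\<^sub>\<infinity>V\<in>range U. tau F \<Lambda> V)"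
      unfolding Cat_def by (intro INF_lower) simp
    then show ?thesis using le by simp
  qed
  then have "Cat F \<Lambda> \<le> 0" by (rule ennreal_le_epsilon)
  then show ?thesis by simp
qed

end
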